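(* Let $K=\mathbb{Q}_2(\sqrt{5})$ and let $d=2m$ with $m\ge3$ odd. Then every additive form $a_1x_1^d+\dots+a_sx_s^d$ with $a_i\in K$ in $s\ge 7d+1$ variables has a nontrivial zero in $K$; i.e. $\Gamma^*(d,K)\le 7d+1$.
   Context: A nontrivial zero is a point $(x_1,\dots,x_s)\in K^s\setminus\{0\}$ at which the form vanishes. $\Gamma^*(d,K)$ denotes the least integer $N$ such that every additive form of degree $d$ over $K$ in at least $N$ variables has a nontrivial zero in $K$. *)

theory Defs
  imports "HOL-Computational_Algebra.Computational_Algebra"
begin

(* The ring of 2-adic integers as the inverse limit of the rings Z/2^n: the n-th component
   of an element is its canonical representative in {0..<2^n}. *)

typedef zadic2 = "{x :: nat \<Rightarrow> int. \<forall>n. x n = x (Suc n) mod 2 ^ n}"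
  morphisms residue Abs_zadic2
  by (rule exI[of _ "\<lambda>_. 0"]) simp

setup_lifting type_definition_zadic2

lemma mod_two_power_Suc: "(a :: int) mod 2 ^ Suc n mod 2 ^ n = a mod 2 ^ n"
  by (rule mod_mod_cancel) simp

lemma
  fixes x y :: int
  assumes "x = x' mod 2 ^ n"
  shows mod_two_power_Suc_minus: "(- x) mod 2 ^ n = (- x') mod 2 ^ Suc n mod 2 ^ n"
    and mod_two_power_Suc_add: "y = y' mod 2 ^ n \<Longrightarrow> (x + y) mod 2 ^ n = (x' + y') mod 2 ^ Suc n mod 2 ^ n"
    and mod_two_power_Suc_diff: "y = y' mod 2 ^ n \<Longrightarrow> (x - y) mod 2 ^ n = (x' - y') mod 2 ^ Suc n mod 2 ^ n"
    and mod_two_power_Suc_mult: "y = y' mod 2 ^ n \<Longrightarrow> (x * y) mod 2 ^ n = (x' * y') mod 2 ^ Suc n mod 2 ^ n"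
  unfolding mod_two_power_Suc assms by (simp_all only: mod_simps)

lemma residue_Suc: "residue x (Suc n) mod 2 ^ n = residue x n"
proof -
  have "\<forall>n. residue x n = residue x (Suc n) mod 2 ^ n"
    using residue[of x] by (rule CollectD)
  then show ?thesis by (blast intro: sym)
qed

lemma residue_mod: "residue x n mod 2 ^ n = residue x n"
  by (metis residue_Suc mod_mod_trivial)

lemma residue_add_mod: "residue x (n + k) mod 2 ^ n = residue x n"
proof (induction k)
  case 0
  then show ?case by (simp add: residue_mod)
next
  case (Suc k)
  have "residue x (n + Suc k) mod 2 ^ n = residue x (Suc (n + k)) mod 2 ^ (n + k) mod 2 ^ n"
    by (subst mod_mod_cancel) (simp_all add: le_imp_power_dvd)
  then show ?case using Suc by (simp only: residue_Suc)
qed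

instantiation zadic2 :: comm_ring_1
begin

lift_definition zero_zadic2 :: zadic2 is "\<lambda>_. 0" by simp

lift_definition one_zadic2 :: zadic2 is "\<lambda>n. 1 mod 2 ^ n"
  by (simp only: mod_two_power_Suc)

lift_definition plus_zadic2 :: "zadic2 \<Rightarrow> zadic2 \<Rightarrow> zadic2" is "\<lambda>x y n. (x n + y n) mod 2 ^ n"
  by (blast intro: mod_two_power_Suc_add)

lift_definition uminus_zadic2 :: "zadic2 \<Rightarrow> zadic2" is "\<lambda>x n. (- x n) mod 2 ^ n"
  by (blast intro: mod_two_power_Suc_minus)

lift_definition minus_zadic2 :: "zadic2 \<Rightarrow> zadic2 \<Rightarrow> zadic2" is "\<lambda>x y n. (x n - y n) mod 2 ^ n"
  by (blast intro: mod_two_power_Suc_diff)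

lift_definition times_zadic2 :: "zadic2 \<Rightarrow> zadic2 \<Rightarrow> zadic2" is "\<lambda>x y n. (x n * y n) mod 2 ^ n"
  by (blast intro: mod_two_power_Suc_mult)

lemma zadic2_eqI: "(\<And>n. residue x n = residue y n) \<Longrightarrow> x = y"
  by (metis residue_inject ext)

lemmas residue_simps = zero_zadic2.rep_eq one_zadic2.rep_eq plus_zadic2.rep_eq
  uminus_zadic2.rep_eq minus_zadic2.rep_eq times_zadic2.rep_eq

instance
proof
  fix a b c :: zadic2
  show "a * b * c = a * (b * c)"
    by (rule zadic2_eqI) (simp add: residue_simps mod_simps mult.assoc)
  show "a * b = b * a"
    by (rule zadic2_eqI) (simp add: residue_simps mult.commute)
  show "1 * a = a"
    by (rule zadic2_eqI) (simp only: residue_simps mod_simps mult_1_left residue_mod)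
  show "a + b + c = a + (b + c)"
    by (rule zadic2_eqI) (simp add: residue_simps mod_simps add.assoc)
  show "a + b = b + a"
    by (rule zadic2_eqI) (simp add: residue_simps add.commute)
  show "0 + a = a"
    by (rule zadic2_eqI) (simp add: residue_simps residue_mod)
  show "- a + a = 0"
    by (rule zadic2_eqI) (simp add: residue_simps mod_simps)
  show "a - b = a + - b"
    by (rule zadic2_eqI) (simp add: residue_simps mod_simps)
  show "(a + b) * c = a * c + b * c"
    by (rule zadic2_eqI) (simp add: residue_simps mod_simps algebra_simps)
  show "(0 :: zadic2) \<noteq> 1"
  proof
    assume "(0 :: zadic2) = 1"
    then have "residue 0 1 = residue 1 1" by simp
    then show False by (simp add: residue_simps)
  qed
qed

end

lemma two_power_dvd_mult_cases:
  fixes a b :: int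
  assumes "2 ^ (k + l) dvd a * b"
  shows "2 ^ k dvd a \<or> 2 ^ l dvd b"
proof (cases "a = 0 \<or> b = 0")
  case True
  then show ?thesis by auto
next
  case False
  have "k + l \<le> multiplicity 2 (a * b)"
    using assms False by (subst (asm) power_dvd_iff_le_multiplicity) auto
  also have "\<dots> = multiplicity 2 a + multiplicity 2 b"
    using False by (intro prime_elem_multiplicity_mult_distrib) auto
  finally have "k \<le> multiplicity 2 a \<or> l \<le> multiplicity 2 b" by linarith
  then show ?thesis by (metis multiplicity_dvd')
qed

lemma zadic2_neq_0E:
  assumes "x \<noteq> (0 :: zadic2)"
  obtains k where "\<forall>j. \<not> 2 ^ k dvd residue x (k + j)"
proof -
  obtain k where "residue x k \<noteq> 0"
    using assms zadic2_eqI[of x 0] by (auto simp: residue_simps)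
  then show thesis
    using that[of k] residue_add_mod[of x k] by (simp add: dvd_eq_mod_eq_0)
qed

instance zadic2 :: idom
proof
  fix a b :: zadic2
  assume "a \<noteq> 0" "b \<noteq> 0"
  obtain k where k: "\<forall>j. \<not> 2 ^ k dvd residue a (k + j)"
    using \<open>a \<noteq> 0\<close> by (rule zadic2_neq_0E)
  obtain l where l: "\<forall>j. \<not> 2 ^ l dvd residue b (l + j)"
    using \<open>b \<noteq> 0\<close> by (rule zadic2_neq_0E)
  show "a * b \<noteq> 0"
  proof
    assume "a * b = 0"
    then have "residue (a * b) (k + l) = 0" by (simp add: residue_simps)
    then have "2 ^ (k + l) dvd residue a (k + l) * residue b (k + l)"
      by (simp add: residue_simps dvd_eq_mod_eq_0)
    then have "2 ^ k dvd residue a (k + l) \<or> 2 ^ l dvd residue b (k + l)"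
      by (rule two_power_dvd_mult_cases)
    then show False
      using spec[OF k, of l] spec[OF l, of k] by (simp add: add.commute)
  qed
qed

type_synonym qadic2 = "zadic2 fract"

lemma odd_square_mod_8:
  assumes "odd (u :: int)"
  shows "u * u mod 8 = 1"
proof -
  from assms obtain k where u: "u = 2 * k + 1" by (rule oddE)
  have "even (k * (k + 1))" by simp
  then obtain l where l: "k * (k + 1) = 2 * l" by (rule evenE)
  have "u * u = 1 + 4 * (k * (k + 1))" by (simp add: u algebra_simps)
  then have "u * u = 1 + 8 * l" by (simp only: l)
  then show ?thesis by simp
qed

lemma square_minus_5_square_descent:
  fixes u v :: int
  assumes "2 ^ (2 * k + 3) dvd u * u - 5 * (v * v)"
  shows "2 ^ k dvd v"
  using assms
proof (induction k arbitrary: u v)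
  case 0
  then show ?case by simp
next
  case (Suc k)
  have "(2 :: int) ^ 3 dvd 2 ^ (2 * Suc k + 3)" by (rule le_imp_power_dvd) simp
  then have "2 ^ 3 dvd u * u - 5 * (v * v)" using Suc.prems by (rule dvd_trans)
  then have "8 dvd u * u - 5 * (v * v)" by simp
  then have cong: "u * u mod 8 = (5 * (v * v)) mod 8" by (simp add: mod_eq_dvd_iff)
  have par: "even u \<longleftrightarrow> even v"
  proof -
    have "even (u * u - 5 * (v * v))" using \<open>8 dvd u * u - 5 * (v * v)\<close> by (rule dvd_trans[rotated]) simp
    then show ?thesis by simp
  qed
  have "even v"
  proof (rule ccontr)
    assume "odd v"
    with par have "u * u mod 8 = 1" "v * v mod 8 = 1" by (simp_all add: odd_square_mod_8)
    then have "5 * (v * v) mod 8 = 5" by (simp add: mod_mult_right_eq[symmetric, of 5 "v * v"])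
    with cong \<open>u * u mod 8 = 1\<close> show False by simp
  qed
  with par obtain u' v' where uv: "u = 2 * u'" "v = 2 * v'" by (meson evenE)
  have pow: "2 ^ (2 * Suc k + 3) = (4 :: int) * 2 ^ (2 * k + 3)" by (simp add: power_add)
  have "u * u - 5 * (v * v) = 4 * (u' * u' - 5 * (v' * v'))" by (simp add: uv)
  with Suc.prems have "4 * 2 ^ (2 * k + 3) dvd 4 * (u' * u' - 5 * (v' * v'))" by (simp only: pow)
  then have "2 ^ (2 * k + 3) dvd u' * u' - 5 * (v' * v')"
    by (subst (asm) dvd_mult_cancel_left) simp
  then show ?case using Suc.IH uv by simp
qed

lemma zadic2_square_eq_5_square:
  fixes u v :: zadic2
  assumes "u * u = 5 * (v * v)"
  shows "v = 0"
proof (rule ccontr)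
  assume "v \<noteq> 0"
  then obtain k where k: "\<forall>j. \<not> 2 ^ k dvd residue v (k + j)" by (rule zadic2_neq_0E)
  define n where "n = 2 * k + 3"
  have "u * u = v * v + v * v + v * v + v * v + v * v" by (simp add: assms)
  then have "residue (u * u) n = residue (v * v + v * v + v * v + v * v + v * v) n" by (simp only:)
  then have "(residue u n * residue u n) mod 2 ^ n = (residue v n * residue v n + residue v n * residue v n
      + residue v n * residue v n + residue v n * residue v n + residue v n * residue v n) mod 2 ^ n"
    by (simp only: residue_simps mod_simps)
  then have "2 ^ n dvd residue u n * residue u n - 5 * (residue v n * residue v n)"
    by (simp add: mod_eq_dvd_iff)
  then have "2 ^ k dvd residue v n"
    unfolding n_def by (rule square_minus_5_square_descent)
  moreover have "n = k + (k + 3)" by (simp add: n_def)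
  ultimately show False using k by blast
qed

lemma five_not_square_qadic2: "x * x \<noteq> (5 :: qadic2)"
proof
  assume sq: "x * x = 5"
  obtain u v where x: "x = Fract u v" and v: "v \<noteq> 0" by (cases x) auto
  have "(5 :: qadic2) = Fract 5 1" using Fract_of_nat_eq[of 5, where ?'a = zadic2] by simp
  with sq x v have "u * u = 5 * (v * v)" by (simp add: eq_fract)
  with zadic2_square_eq_5_square v show False by blast
qed

(* K = Q_2(sqrt 5), with Q2Sqrt5 a b standing for a + b * sqrt 5. *)

datatype qadic2_sqrt5 = Q2Sqrt5 (rat_part: qadic2) (irr_part: qadic2)

lemma qadic2_sqrt5_eqI: "rat_part x = rat_part y \<Longrightarrow> irr_part x = irr_part y \<Longrightarrow> x = y"
  by (rule qadic2_sqrt5.expand) simp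

definition norm_sqrt5 :: "qadic2_sqrt5 \<Rightarrow> qadic2" where
  "norm_sqrt5 x = rat_part x * rat_part x - 5 * (irr_part x * irr_part x)"

lemma norm_sqrt5_eq_0:
  assumes "norm_sqrt5 x = 0"
  shows "rat_part x = 0 \<and> irr_part x = 0"
proof (cases "irr_part x = 0")
  case True
  with assms show ?thesis by (simp add: norm_sqrt5_def)
next
  case False
  with assms have "rat_part x / irr_part x * (rat_part x / irr_part x) = 5"
    by (simp add: norm_sqrt5_def field_simps)
  with five_not_square_qadic2 show ?thesis by blast
qed

instantiation qadic2_sqrt5 :: field
begin

definition zero_qadic2_sqrt5 :: qadic2_sqrt5 where
  "0 = Q2Sqrt5 0 0"

definition one_qadic2_sqrt5 :: qadic2_sqrt5 where
  "1 = Q2Sqrt5 1 0"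

definition plus_qadic2_sqrt5 :: "qadic2_sqrt5 \<Rightarrow> qadic2_sqrt5 \<Rightarrow> qadic2_sqrt5" where
  "x + y = Q2Sqrt5 (rat_part x + rat_part y) (irr_part x + irr_part y)"

definition uminus_qadic2_sqrt5 :: "qadic2_sqrt5 \<Rightarrow> qadic2_sqrt5" where
  "- x = Q2Sqrt5 (- rat_part x) (- irr_part x)"

definition minus_qadic2_sqrt5 :: "qadic2_sqrt5 \<Rightarrow> qadic2_sqrt5 \<Rightarrow> qadic2_sqrt5" where
  "x - y = Q2Sqrt5 (rat_part x - rat_part y) (irr_part x - irr_part y)"

definition times_qadic2_sqrt5 :: "qadic2_sqrt5 \<Rightarrow> qadic2_sqrt5 \<Rightarrow> qadic2_sqrt5" where
  "x * y = Q2Sqrt5 (rat_part x * rat_part y + 5 * (irr_part x * irr_part y))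
                   (rat_part x * irr_part y + irr_part x * rat_part y)"

definition inverse_qadic2_sqrt5 :: "qadic2_sqrt5 \<Rightarrow> qadic2_sqrt5" where
  "inverse x = Q2Sqrt5 (rat_part x / norm_sqrt5 x) (- irr_part x / norm_sqrt5 x)"

definition divide_qadic2_sqrt5 :: "qadic2_sqrt5 \<Rightarrow> qadic2_sqrt5 \<Rightarrow> qadic2_sqrt5" where
  "x div y = x * inverse (y :: qadic2_sqrt5)"

lemmas qadic2_sqrt5_defs = zero_qadic2_sqrt5_def one_qadic2_sqrt5_def plus_qadic2_sqrt5_def
  uminus_qadic2_sqrt5_def minus_qadic2_sqrt5_def times_qadic2_sqrt5_def

instance
proof
  fix a b c :: qadic2_sqrt5
  show "a * b * c = a * (b * c)" "a * b = b * a" "1 * a = a" "(a + b) * c = a * c + b * c"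
    "a + b + c = a + (b + c)" "a + b = b + a" "0 + a = a" "- a + a = 0" "a - b = a + - b"
    "(0 :: qadic2_sqrt5) \<noteq> 1"
    by (simp_all add: qadic2_sqrt5_defs algebra_simps)
  show "a div b = a * inverse b" by (rule divide_qadic2_sqrt5_def)
  show "inverse (0 :: qadic2_sqrt5) = 0"
    by (simp add: inverse_qadic2_sqrt5_def zero_qadic2_sqrt5_def)
  assume "a \<noteq> 0"
  then have "norm_sqrt5 a \<noteq> 0"
    using norm_sqrt5_eq_0[of a] by (auto simp: zero_qadic2_sqrt5_def intro: qadic2_sqrt5_eqI)
  then have "rat_part a * (rat_part a / norm_sqrt5 a)
      + 5 * (irr_part a * (- irr_part a / norm_sqrt5 a)) = 1"
    by (simp add: field_simps) (simp add: norm_sqrt5_def algebra_simps)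
  then show "inverse a * a = 1"
    by (simp add: inverse_qadic2_sqrt5_def one_qadic2_sqrt5_def times_qadic2_sqrt5_def mult.commute)
qed

end

definition of_qadic2 :: "qadic2 \<Rightarrow> qadic2_sqrt5" where
  "of_qadic2 a = Q2Sqrt5 a 0"

definition sqrt5 :: qadic2_sqrt5 where
  "sqrt5 = Q2Sqrt5 0 1"

lemma of_qadic2_hom:
  "of_qadic2 0 = 0" "of_qadic2 1 = 1"
  "of_qadic2 (a + b) = of_qadic2 a + of_qadic2 b" "of_qadic2 (a * b) = of_qadic2 a * of_qadic2 b"
  by (simp_all add: of_qadic2_def qadic2_sqrt5_defs)

lemma of_qadic2_numeral: "of_qadic2 (numeral n) = numeral n"
  by (induction n) (simp_all only: numeral.simps of_qadic2_hom)

lemma sqrt5_square: "sqrt5 ^ 2 = 5"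
proof -
  have "sqrt5 ^ 2 = of_qadic2 5"
    by (simp add: sqrt5_def of_qadic2_def power2_eq_square times_qadic2_sqrt5_def)
  then show ?thesis by (simp only: of_qadic2_numeral)
qed

lemma qadic2_sqrt5_decomp: "x = of_qadic2 (rat_part x) + of_qadic2 (irr_part x) * sqrt5"
  by (simp add: of_qadic2_def sqrt5_def qadic2_sqrt5_defs)

(* Forms in s variables: of the coefficient and variable sequences only the entries with
   index < s matter, so they represent elements of 'a^s. *)

definition additive_form :: "nat \<Rightarrow> nat \<Rightarrow> (nat \<Rightarrow> 'a::field) \<Rightarrow> (nat \<Rightarrow> 'a) \<Rightarrow> 'a" where
  "additive_form d s a x = (\<Sum>i<s. a i * x i ^ d)"

definition has_nontrivial_zero :: "nat \<Rightarrow> ((nat \<Rightarrow> 'a::field) \<Rightarrow> 'a) \<Rightarrow> bool" where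
  "has_nontrivial_zero s f \<longleftrightarrow> (\<exists>x. (\<exists>i<s. x i \<noteq> 0) \<and> f x = 0)"

(* LEAST is a meaningful value only if some N has the property. *)

definition Gamma_star :: "nat \<Rightarrow> 'a::field itself \<Rightarrow> nat" where
  "Gamma_star d _ = (LEAST N. \<forall>s\<ge>N. \<forall>a :: nat \<Rightarrow> 'a. has_nontrivial_zero s (additive_form d s a))"

end

(* By Hensel's lemma it suffices to solve the form mod 8 with a unit among the variables of lowest
   level, using only x_i = 0, 1 and sqrt 5, where sqrt 5 ^ d = 5 mod 8. Normalise the coefficients to
   2 ^ l * unit with l < d. Some cyclically consecutive levels j, j + 1 carry s_0 >= 8 and
   s_0 + s_1 >= 15 variables; only these are used. A zero sum mod 4 lifts to one mod 8 if the units
   in it have two classes in F_4, because the corrections 4 u_i then span 4 O / 8 O. A zero sum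
   within one class c, equal to 4 t, lifts if t lies in the line {0, c}, and of two disjoint zero
   sums mod 4 one, or their union, always lifts. Short zero sums in (Z/4)^2 give two disjoint ones
   if s_0 >= 11, and short zero sums in Z/4 x Z/2, completed by one level 1 variable each, if
   s_0 = 9 or 10. If s_0 = 8, then s_1 >= 7, and either level 1 has two classes, which corrects an
   even sum at level 0 to a zero sum mod 4, or seven level 1 coefficients of one class already
   have a liftable zero sum. *)

theory Submission
  imports Defs
begin

section \<open>The 2-adic integers\<close>

lemma residue_power: "residue (x ^ k) n = residue x n ^ k mod 2 ^ n"
  by (induction k) (simp_all add: residue_simps mod_simps)

lemma residue_two_power: "residue (2 ^ k) n = 2 ^ k mod 2 ^ n"
proof -
  have "residue (2 :: zadic2) n = residue (1 + 1) n" by simp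
  also have "\<dots> = 2 mod 2 ^ n" unfolding residue_simps by (simp add: mod_simps)
  finally have "residue 2 n = 2 mod 2 ^ n" .
  then show ?thesis by (simp add: residue_power mod_simps)
qed

lemma zadic2_two_power_dvd_iff: "2 ^ n dvd x \<longleftrightarrow> residue x n = 0"
proof
  assume "2 ^ n dvd x"
  then show "residue x n = 0" by (auto elim!: dvdE simp: residue_simps residue_two_power)
next
  assume 0: "residue x n = 0"
  \<comment> \<open>Candidate for the quotient: its residue modulo 2 ^ k depends on x modulo 2 ^ (n
    + k), hence the shifted index.\<close>
  define y where "y k = residue x (n + k) div 2 ^ n" for k
  have x: "residue x (n + k) = 2 ^ n * y k" for k
    using residue_add_mod[of x n k] 0 by (simp add: y_def dvd_eq_mod_eq_0)
  have "y k = y (Suc k) mod 2 ^ k" for k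
  proof -
    have "2 ^ n * y k = residue x (Suc (n + k)) mod 2 ^ (n + k)"
      by (simp add: residue_Suc x)
    also have "\<dots> = 2 ^ n * (y (Suc k) mod 2 ^ k)"
      using x[of "Suc k"] by (simp add: power_add)
    finally show ?thesis by simp
  qed
  then have y: "residue (Abs_zadic2 y) = y"
    by (intro Abs_zadic2_inverse CollectI allI)
  have "x = 2 ^ n * Abs_zadic2 y"
  proof (rule zadic2_eqI)
    fix k
    have "residue x k = residue x (k + n) mod 2 ^ k" by (rule residue_add_mod[symmetric])
    also have "\<dots> = (2 ^ n * y k) mod 2 ^ k" by (simp only: add.commute[of k n] x)
    also have "\<dots> = residue (2 ^ n * Abs_zadic2 y) k"
      by (simp add: residue_simps y residue_two_power mod_simps)
    finally show "residue x k = residue (2 ^ n * Abs_zadic2 y) k" .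
  qed
  then show "2 ^ n dvd x" by simp
qed

text \<open>Completeness of the 2-adic integers: from index n on the sequence is constant modulo 2 ^
  n, so the n-th residues of \<open>s n\<close> are compatible and define the limit.\<close>

lemma zadic2_cauchy:
  fixes s :: "nat \<Rightarrow> zadic2"
  assumes "\<And>n. 2 ^ n dvd s (Suc n) - s n"
  obtains x where "\<And>n. 2 ^ n dvd x - s n"
proof -
  have diff: "2 ^ n dvd x - y \<longleftrightarrow> residue x n = residue y n" for n and x y :: zadic2
    by (metis dvd_eq_mod_eq_0 minus_zadic2.rep_eq mod_eq_dvd_iff residue_mod zadic2_two_power_dvd_iff)
  have "residue (s n) n = residue (s (Suc n)) (Suc n) mod 2 ^ n" for n
    using assms[of n] by (simp add: diff residue_Suc)
  then have "residue (Abs_zadic2 (\<lambda>n. residue (s n) n)) = (\<lambda>n. residue (s n) n)"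
    by (intro Abs_zadic2_inverse CollectI allI)
  then show ?thesis
    by (intro that[of "Abs_zadic2 (\<lambda>n. residue (s n) n)"]) (simp add: diff)
qed

lemma zadic2_infinitely_divisible:
  fixes x :: zadic2
  assumes "\<And>n. 2 ^ n dvd x"
  shows "x = 0"
  using assms by (intro zadic2_eqI) (simp add: zadic2_two_power_dvd_iff residue_simps)

definition parity :: "zadic2 \<Rightarrow> bool" where
  "parity x \<longleftrightarrow> odd (residue x 1)"

lemma parity_simps [simp]:
  "\<not> parity 0" "parity 1" "parity (x + y) \<longleftrightarrow> parity x \<noteq> parity y"
  "parity (- x) \<longleftrightarrow> parity x" "parity (x - y) \<longleftrightarrow> parity x \<noteq> parity y"
  "parity (x * y) \<longleftrightarrow> parity x \<and> parity y"
  by (auto simp: parity_def residue_simps)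

lemma two_dvd_zadic2: "2 dvd x \<longleftrightarrow> \<not> parity x"
  using zadic2_two_power_dvd_iff[of 1 x] residue_mod[of x 1]
  by (auto simp: parity_def mod_2_eq_odd split: if_splits)

section \<open>The ring of integers of K\<close>

(* The ring of integers of K, with ZPhi a b standing for a + b * phi, phi = (1 + sqrt 5) / 2. *)

datatype zadic2_phi = ZPhi (one_part: zadic2) (phi_part: zadic2)

lemma zadic2_phi_eqI: "one_part x = one_part y \<Longrightarrow> phi_part x = phi_part y \<Longrightarrow> x = y"
  by (rule zadic2_phi.expand) simp

instantiation zadic2_phi :: comm_ring_1
begin

definition zero_zadic2_phi :: zadic2_phi where
  "0 = ZPhi 0 0"

definition one_zadic2_phi :: zadic2_phi where
  "1 = ZPhi 1 0"

definition plus_zadic2_phi :: "zadic2_phi \<Rightarrow> zadic2_phi \<Rightarrow> zadic2_phi" where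
  "x + y = ZPhi (one_part x + one_part y) (phi_part x + phi_part y)"

definition uminus_zadic2_phi :: "zadic2_phi \<Rightarrow> zadic2_phi" where
  "- x = ZPhi (- one_part x) (- phi_part x)"

definition minus_zadic2_phi :: "zadic2_phi \<Rightarrow> zadic2_phi \<Rightarrow> zadic2_phi" where
  "x - y = ZPhi (one_part x - one_part y) (phi_part x - phi_part y)"

text \<open>The product expanded with phi ^ 2 = phi + 1.\<close>

definition times_zadic2_phi :: "zadic2_phi \<Rightarrow> zadic2_phi \<Rightarrow> zadic2_phi" where
  "x * y = ZPhi (one_part x * one_part y + phi_part x * phi_part y)
                (one_part x * phi_part y + phi_part x * one_part y + phi_part x * phi_part y)"

lemmas zadic2_phi_defs = zero_zadic2_phi_def one_zadic2_phi_def plus_zadic2_phi_def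
  uminus_zadic2_phi_def minus_zadic2_phi_def times_zadic2_phi_def

instance
  by standard (simp_all add: zadic2_phi_defs algebra_simps)

end

lemma zadic2_phi_sel [simp]:
  "one_part 0 = 0" "phi_part 0 = 0" "one_part 1 = 1" "phi_part 1 = 0"
  "one_part (x + y) = one_part x + one_part y" "phi_part (x + y) = phi_part x + phi_part y"
  "one_part (- x) = - one_part x" "phi_part (- x) = - phi_part x"
  "one_part (x - y) = one_part x - one_part y" "phi_part (x - y) = phi_part x - phi_part y"
  by (simp_all add: zadic2_phi_defs)

lemma two_power_mult_zadic2_phi:
  "2 ^ n * x = ZPhi (2 ^ n * one_part x) (2 ^ n * phi_part x)"
proof (induction n arbitrary: x)
  case 0
  then show ?case by simp
next
  case (Suc n)
  have "2 ^ Suc n * x = 2 ^ n * (x + x)" by (simp add: algebra_simps)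
  also have "\<dots> = ZPhi (2 ^ n * one_part (x + x)) (2 ^ n * phi_part (x + x))" by (rule Suc)
  also have "one_part (x + x) = 2 * one_part x" by (simp only: zadic2_phi_sel mult_2)
  also have "phi_part (x + x) = 2 * phi_part x" by (simp only: zadic2_phi_sel mult_2)
  finally show ?case by (simp only: power_Suc2 mult.assoc)
qed

lemma zadic2_phi_two_power_dvd_iff: "2 ^ n dvd x \<longleftrightarrow> 2 ^ n dvd one_part x \<and> 2 ^ n dvd phi_part x"
proof
  assume "2 ^ n dvd x"
  then show "2 ^ n dvd one_part x \<and> 2 ^ n dvd phi_part x"
    by (auto elim!: dvdE simp: two_power_mult_zadic2_phi)
next
  assume "2 ^ n dvd one_part x \<and> 2 ^ n dvd phi_part x"
  then obtain a b where "one_part x = 2 ^ n * a" "phi_part x = 2 ^ n * b" by (auto elim!: dvdE)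
  then have "x = 2 ^ n * ZPhi a b"
    by (intro zadic2_phi_eqI) (simp_all add: two_power_mult_zadic2_phi)
  then show "2 ^ n dvd x" by simp
qed

lemma zadic2_phi_cauchy:
  fixes s :: "nat \<Rightarrow> zadic2_phi"
  assumes "\<And>n. 2 ^ n dvd s (Suc n) - s n"
  obtains x where "\<And>n. 2 ^ n dvd x - s n"
proof -
  obtain a where "\<And>n. 2 ^ n dvd a - one_part (s n)"
    using assms by (auto intro: zadic2_cauchy[of "\<lambda>n. one_part (s n)"] simp: zadic2_phi_two_power_dvd_iff)
  moreover obtain b where "\<And>n. 2 ^ n dvd b - phi_part (s n)"
    using assms by (auto intro: zadic2_cauchy[of "\<lambda>n. phi_part (s n)"] simp: zadic2_phi_two_power_dvd_iff)
  ultimately show ?thesis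
    by (intro that[of "ZPhi a b"]) (simp add: zadic2_phi_two_power_dvd_iff)
qed

lemma zadic2_phi_infinitely_divisible:
  fixes x :: zadic2_phi
  assumes "\<And>n. 2 ^ n dvd x"
  shows "x = 0"
proof (rule zadic2_phi_eqI)
  have "2 ^ n dvd one_part x" "2 ^ n dvd phi_part x" for n
    using assms[of n] unfolding zadic2_phi_two_power_dvd_iff by blast+
  then show "one_part x = one_part 0" "phi_part x = phi_part 0"
    unfolding zadic2_phi_sel by (blast intro: zadic2_infinitely_divisible)+
qed

(* The residue class of x in F_4 = F_2[phi] has coordinates par1 x and par2 x. *)

definition par1 :: "zadic2_phi \<Rightarrow> bool" where
  "par1 x = parity (one_part x)"

definition par2 :: "zadic2_phi \<Rightarrow> bool" where
  "par2 x = parity (phi_part x)"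

lemma par_simps [simp]:
  "\<not> par1 0" "par1 1" "par1 (x + y) \<longleftrightarrow> par1 x \<noteq> par1 y" "par1 (x - y) \<longleftrightarrow> par1 x \<noteq> par1 y"
  "\<not> par2 0" "\<not> par2 1" "par2 (x + y) \<longleftrightarrow> par2 x \<noteq> par2 y" "par2 (x - y) \<longleftrightarrow> par2 x \<noteq> par2 y"
  "par1 (- x) \<longleftrightarrow> par1 x" "par2 (- x) \<longleftrightarrow> par2 x"
  by (simp_all add: par1_def par2_def)

lemma par_mult:
  "par1 (x * y) \<longleftrightarrow> (par1 x \<and> par1 y) \<noteq> (par2 x \<and> par2 y)"
  "par2 (x * y) \<longleftrightarrow> ((par1 x \<and> par2 y) \<noteq> (par2 x \<and> par1 y)) \<noteq> (par2 x \<and> par2 y)"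
  by (simp_all add: par1_def par2_def times_zadic2_phi_def)

lemma two_dvd_zadic2_phi: "2 dvd x \<longleftrightarrow> \<not> par1 x \<and> \<not> par2 x"
  using zadic2_phi_two_power_dvd_iff[of 1 x] by (simp add: two_dvd_zadic2 par1_def par2_def)

text \<open>The prime 2 is inert in K, so these are the units of O.\<close>

definition primitive :: "zadic2_phi \<Rightarrow> bool" where
  "primitive u \<longleftrightarrow> \<not> 2 dvd u"

lemma primitive_iff: "primitive u \<longleftrightarrow> par1 u \<or> par2 u"
  by (auto simp: primitive_def two_dvd_zadic2_phi)

text \<open>The multiplicative group of F_4 has order 3. Thus u ^ 2 inverts u modulo 2, which spares
  a quotient in the Newton step.\<close>

lemma primitive_cube:
  assumes "primitive u"
  shows "2 dvd u ^ 3 - 1"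
  using assms by (auto simp: two_dvd_zadic2_phi par_mult primitive_iff power3_eq_cube)

lemma zadic2_phi_factor:
  assumes "x \<noteq> 0"
  obtains n u where "x = 2 ^ n * u" "primitive u"
proof -
  obtain k where "\<not> 2 ^ k dvd x" using assms zadic2_phi_infinitely_divisible by blast
  then obtain n where n: "2 ^ n dvd x" "\<not> 2 ^ Suc n dvd x"
    by (induction k) auto
  then obtain u where u: "x = 2 ^ n * u" by blast
  with n(2) have "primitive u"
    using mult_dvd_mono[of "2 ^ n" "2 ^ n" 2 u] by (auto simp: primitive_def mult.commute)
  with u that show ?thesis by blast
qed

section \<open>Hensel's lemma\<close>

text \<open>First-order Taylor expansion with a remainder divisible by h ^ 2.\<close>

lemma power_add_second_order:
  fixes y h :: "'a :: comm_ring_1"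
  obtains r where "(y + h) ^ d = y ^ d + of_nat d * y ^ (d - 1) * h + h ^ 2 * r"
proof -
  have "\<exists>r. (y + h) ^ d = y ^ d + of_nat d * y ^ (d - 1) * h + h ^ 2 * r"
  proof (induction d)
    case 0
    show ?case by (intro exI[of _ 0]) simp
  next
    case (Suc d)
    then obtain r where r: "(y + h) ^ d = y ^ d + of_nat d * y ^ (d - 1) * h + h ^ 2 * r" by blast
    have yd: "of_nat d * y ^ (d - 1) * y = of_nat d * y ^ d" by (cases d) simp_all
    have "(y + h) ^ Suc d = (y + h) * (y ^ d + of_nat d * y ^ (d - 1) * h + h ^ 2 * r)"
      by (simp add: r)
    also have "\<dots> = y ^ Suc d + (of_nat d * y ^ (d - 1) * y + y ^ d) * h
        + h ^ 2 * (y * r + of_nat d * y ^ (d - 1) + h * r)"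
      by (simp add: algebra_simps power2_eq_square)
    also have "\<dots> = y ^ Suc d + of_nat (Suc d) * y ^ d * h
        + h ^ 2 * (y * r + of_nat d * y ^ (d - 1) + h * r)"
      unfolding yd by (simp add: algebra_simps)
    finally show ?case by auto
  qed
  with that show ?thesis by blast
qed

lemma par_power_one:
  assumes "2 dvd y - 1"
  shows "2 dvd y ^ n - (1 :: zadic2_phi)"
proof -
  have "y - 1 dvd y ^ n - 1" by (metis dvd_triv_left power_diff_1_eq)
  with assms show ?thesis by (rule dvd_trans)
qed

lemma two_dvd_odd_minus_1:
  assumes "odd m"
  shows "2 dvd of_nat m - (1 :: 'a :: comm_ring_1)"
proof -
  obtain k where "m = 2 * k + 1" using assms by (rule oddE)
  then show ?thesis by simp
qed

text \<open>The derivative 2 * m * u * y ^ (2 * m - 1) is divisible by 2 exactly once, as m is odd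
  and u and y are units. Changing y by a multiple of 2 ^ (n + 2) therefore corrects the value at
  precision 2 ^ (n + 3), while the quadratic term is a multiple of 2 ^ (2 * n + 4). This is why the
  start is a zero modulo 8.\<close>

lemma hensel_step:
  fixes u R y :: zadic2_phi
  assumes u: "primitive u" and "odd m" and y: "2 dvd y - 1"
    and dvd: "2 ^ (n + 3) dvd u * y ^ (2 * m) + R"
  obtains y' where "2 dvd y' - 1" "2 ^ (n + 4) dvd u * y' ^ (2 * m) + R" "2 ^ n dvd y' - y"
proof -
  obtain f where f: "u * y ^ (2 * m) + R = 2 ^ (n + 3) * f" using dvd by (rule dvdE)
  \<comment> \<open>Newton correction with u ^ 2 in place of the inverse of u. Signs do not matter
    modulo 2, so the error f gets multiplied by 1 + g with g = 1 modulo 2.\<close>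
  define h where "h = 2 ^ (n + 2) * (u ^ 2 * f)"
  obtain r where r: "(y + h) ^ (2 * m) = y ^ (2 * m) + of_nat (2 * m) * y ^ (2 * m - 1) * h + h ^ 2 * r"
    by (rule power_add_second_order)
  define g where "g = u ^ 3 * (of_nat m * y ^ (2 * m - 1))"
  have "2 dvd 1 + g"
    using primitive_cube[OF u] par_power_one[OF y, of "2 * m - 1"] two_dvd_odd_minus_1[OF \<open>odd m\<close>, where ?'a = zadic2_phi]
    by (auto simp: g_def two_dvd_zadic2_phi par_mult)
  then obtain k where k: "1 + g = 2 * k" by (rule dvdE)
  have "u * (y + h) ^ (2 * m) + R
      = 2 ^ (n + 3) * f + u * (of_nat (2 * m) * y ^ (2 * m - 1) * h) + u * (h ^ 2 * r)"
    unfolding r f[symmetric] by (simp add: algebra_simps)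
  also have "\<dots> = 2 ^ (n + 3) * f * (1 + g) + 2 ^ (n + 4) * (2 ^ n * (u * (u ^ 2 * f) ^ 2 * r))"
    by (simp add: h_def g_def algebra_simps power_add power2_eq_square power3_eq_cube)
  also have "\<dots> = 2 ^ (n + 4) * (f * k + 2 ^ n * (u * (u ^ 2 * f) ^ 2 * r))"
    unfolding k by (simp add: algebra_simps power_add)
  finally have "2 ^ (n + 4) dvd u * (y + h) ^ (2 * m) + R" by simp
  moreover have h: "h = 2 * (2 ^ (n + 1) * (u ^ 2 * f))" "h = 2 ^ n * (4 * (u ^ 2 * f))"
    by (simp_all add: h_def power_add algebra_simps)
  have "2 dvd h" "2 ^ n dvd h" by (metis h(1) dvd_triv_left) (metis h(2) dvd_triv_left)
  then have "2 dvd y + h - 1" "2 ^ n dvd (y + h) - y"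
    using y by (simp_all add: two_dvd_zadic2_phi)
  ultimately show ?thesis by (intro that)
qed

text \<open>Iterating the step gives a Cauchy sequence; the value at its limit is divisible by every
  power of 2.\<close>

lemma hensel:
  fixes u R y :: zadic2_phi
  assumes u: "primitive u" and m: "odd m" and y: "2 dvd y - 1"
    and dvd: "8 dvd u * y ^ (2 * m) + R"
  obtains z where "2 dvd z - 1" "u * z ^ (2 * m) + R = 0"
proof -
  let ?P = "\<lambda>n x. 2 dvd x - 1 \<and> 2 ^ (n + 3) dvd u * x ^ (2 * m) + R"
  have "\<exists>s. \<forall>n. ?P n (s n) \<and> 2 ^ n dvd s (Suc n) - s n"
  proof (rule dependent_nat_choice)
    show "\<exists>x. ?P 0 x" using y dvd by auto
    show "\<exists>x'. ?P (Suc n) x' \<and> 2 ^ n dvd x' - x" if "?P n x" for n x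
      using hensel_step[OF u m, of x n R] that by (auto simp: numeral_eq_Suc)
  qed
  then obtain s where s: "\<And>n. ?P n (s n)" "\<And>n. 2 ^ n dvd s (Suc n) - s n" by blast
  obtain z where z: "\<And>n. 2 ^ n dvd z - s n" using zadic2_phi_cauchy[OF s(2)] by blast
  have "2 ^ n dvd u * z ^ (2 * m) + R" for n
  proof -
    \<comment> \<open>The difference of the bases divides that of the powers, so the values at z and
      at \<open>s n\<close> agree modulo 2 ^ n.\<close>
    have "z - s n dvd z ^ (2 * m) - s n ^ (2 * m)"
      by (simp add: power_diff_sumr2)
    then have "2 ^ n dvd u * (z ^ (2 * m) - s n ^ (2 * m))"
      using z[of n] by (metis dvd_trans dvd_mult)
    moreover have "2 ^ n dvd u * s n ^ (2 * m) + R"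
      using s(1)[of n] by (metis dvd_mult_left power_add)
    ultimately have "2 ^ n dvd u * (z ^ (2 * m) - s n ^ (2 * m)) + (u * s n ^ (2 * m) + R)"
      by (rule dvd_add)
    then show ?thesis by (simp add: algebra_simps)
  qed
  then have "u * z ^ (2 * m) + R = 0" by (rule zadic2_phi_infinitely_divisible)
  moreover have "2 dvd z - 1"
    using z[of 1] s(1)[of 1] by (auto simp: two_dvd_zadic2_phi)
  ultimately show ?thesis using that by blast
qed

section \<open>Zero sums modulo 8\<close>

(* Since d = 2 m with m odd, sqrt 5 ^ d = 5 ^ m is 5 mod 8; S' marks the variables in S set to
   sqrt 5 instead of 1. *)
definition has_zero_mod_8 :: "('i \<Rightarrow> zadic2_phi) \<Rightarrow> 'i set \<Rightarrow> 'i set \<Rightarrow> bool" where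
  "has_zero_mod_8 u I J \<longleftrightarrow>
    (\<exists>S S' T. S \<subseteq> I \<and> S \<noteq> {} \<and> S' \<subseteq> S \<and> T \<subseteq> J \<and> 8 dvd sum u S + 4 * sum u S' + 2 * sum u T)"

text \<open>Marking S' adds 4 * \<open>sum u S'\<close>, so it suffices that the class of t in F_4
  is a sum of classes from S. Two distinct nonzero classes form a basis of F_4 over F_2, so their
  subset sums are everything.\<close>

lemma has_zero_mod_8I:
  assumes "S \<subseteq> I" "S \<noteq> {}" "T \<subseteq> J" "\<And>i. i \<in> S \<Longrightarrow> primitive (u i)"
    and t: "sum u S + 2 * sum u T = 4 * t"
    and span: "2 dvd t \<or> (\<exists>i\<in>S. 2 dvd t - u i) \<or> (\<exists>i\<in>S. \<exists>j\<in>S. \<not> 2 dvd u i - u j)"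
  shows "has_zero_mod_8 u I J"
proof -
  have "\<exists>S'\<subseteq>S. 2 dvd t + sum u S'"
  proof -
    consider "2 dvd t" | i where "i \<in> S" "2 dvd t - u i"
      | i j where "i \<in> S" "j \<in> S" "\<not> 2 dvd u i - u j" using span by blast
    then show ?thesis
    proof cases
      case 1
      then show ?thesis by (intro exI[of _ "{}"]) simp
    next
      case 2
      then show ?thesis by (intro exI[of _ "{i}"]) (simp add: two_dvd_zadic2_phi)
    next
      case 3
      then have "i \<noteq> j" by auto
      have "2 dvd t + sum u {} \<or> 2 dvd t + sum u {i} \<or> 2 dvd t + sum u {j} \<or> 2 dvd t + sum u {i, j}"
        using 3 assms(4)[of i] assms(4)[of j] \<open>i \<noteq> j\<close>
        by (auto simp: two_dvd_zadic2_phi primitive_iff)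
      with 3 show ?thesis by (metis empty_subsetI insert_subset)
    qed
  qed
  then obtain S' k where "S' \<subseteq> S" and k: "t + sum u S' = 2 * k" by (auto elim!: dvdE)
  have "sum u S + 4 * sum u S' + 2 * sum u T = 4 * (t + sum u S')"
    using t by (simp add: algebra_simps)
  also have "\<dots> = 8 * k" by (simp add: k)
  finally have "8 dvd sum u S + 4 * sum u S' + 2 * sum u T" by simp
  with \<open>S' \<subseteq> S\<close> assms(1-3) show ?thesis unfolding has_zero_mod_8_def by blast
qed

(* If no single zero sum mod 4 lifts, each is monochromatic and the two quotients by 4 lie in the
   nontrivial coset of the line in F_4 spanned by the leading class, so that the union lifts. *)
lemma has_zero_mod_8_two_disjoint:
  assumes fin: "finite I" "finite J" and prim: "\<And>i. i \<in> I \<Longrightarrow> primitive (u i)"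
    and S: "S1 \<subseteq> I" "S2 \<subseteq> I" "S1 \<inter> S2 = {}" "S1 \<noteq> {}" "S2 \<noteq> {}"
    and T: "T1 \<subseteq> J" "T2 \<subseteq> J" "T1 \<inter> T2 = {}"
    and 4: "4 dvd sum u S1 + 2 * sum u T1" "4 dvd sum u S2 + 2 * sum u T2"
  shows "has_zero_mod_8 u I J"
proof (rule ccontr)
  assume no: "\<not> has_zero_mod_8 u I J"
  obtain t1 t2 where t: "sum u S1 + 2 * sum u T1 = 4 * t1" "sum u S2 + 2 * sum u T2 = 4 * t2"
    using 4 by (auto elim!: dvdE)
  have "sum u (S1 \<union> S2) = sum u S1 + sum u S2" "sum u (T1 \<union> T2) = sum u T1 + sum u T2"
    using fin S T by (auto intro!: sum.union_disjoint intro: finite_subset)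
  then have "sum u (S1 \<union> S2) + 2 * sum u (T1 \<union> T2)
      = (sum u S1 + 2 * sum u T1) + (sum u S2 + 2 * sum u T2)" by (simp add: algebra_simps)
  then have t12: "sum u (S1 \<union> S2) + 2 * sum u (T1 \<union> T2) = 4 * (t1 + t2)"
    unfolding t by (simp add: distrib_left)
  have S12: "S1 \<union> S2 \<subseteq> I" "S1 \<union> S2 \<noteq> {}" "T1 \<union> T2 \<subseteq> J" using S T by auto
  have prims: "\<And>i. i \<in> S1 \<union> S2 \<Longrightarrow> primitive (u i)" "\<And>i. i \<in> S1 \<Longrightarrow> primitive (u i)"
    "\<And>i. i \<in> S2 \<Longrightarrow> primitive (u i)" using S prim by auto
  have 12: "\<not> (2 dvd t1 + t2 \<or> (\<exists>i\<in>S1 \<union> S2. 2 dvd t1 + t2 - u i)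
      \<or> (\<exists>i\<in>S1 \<union> S2. \<exists>j\<in>S1 \<union> S2. \<not> 2 dvd u i - u j))"
    using no by (rule contrapos_nn) (rule has_zero_mod_8I[OF S12 prims(1) t12])
  have 1: "\<not> (2 dvd t1 \<or> (\<exists>i\<in>S1. 2 dvd t1 - u i) \<or> (\<exists>i\<in>S1. \<exists>j\<in>S1. \<not> 2 dvd u i - u j))"
    using no by (rule contrapos_nn) (rule has_zero_mod_8I[OF S(1,4) T(1) prims(2) t(1)])
  have 2: "\<not> (2 dvd t2 \<or> (\<exists>i\<in>S2. 2 dvd t2 - u i) \<or> (\<exists>i\<in>S2. \<exists>j\<in>S2. \<not> 2 dvd u i - u j))"
    using no by (rule contrapos_nn) (rule has_zero_mod_8I[OF S(2,5) T(2) prims(3) t(2)])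
  obtain i j where ij: "i \<in> S1" "j \<in> S2" using S by blast
  then have "primitive (u i)" using S prim by blast
  moreover have "\<not> 2 dvd t1 + t2" "\<not> 2 dvd t1 + t2 - u i" "2 dvd u i - u j"
    "\<not> 2 dvd t1" "\<not> 2 dvd t1 - u i" "\<not> 2 dvd t2" "\<not> 2 dvd t2 - u j"
    using 12 1 2 ij by blast+
  ultimately show False
    by (simp add: two_dvd_zadic2_phi primitive_iff) argo
qed

section \<open>Short zero sums modulo 2 and modulo 4\<close>

lemma pigeonhole_pair:
  assumes "finite A" "finite C" "f ` A \<subseteq> C" "card C < card A"
  shows "\<exists>i\<in>A. \<exists>j\<in>A. i \<noteq> j \<and> f i = f j"
proof -
  have "card (f ` A) < card A" using assms by (meson card_mono le_less_trans)
  then have "\<not> inj_on f A" by (rule pigeonhole)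
  then show ?thesis by (auto simp: inj_on_def)
qed

text \<open>F_4 has three nonzero classes, so two of four units agree modulo 2.\<close>

lemma primitive_pair:
  assumes fin: "finite A" and card: "4 \<le> card A" and prim: "\<And>i. i \<in> A \<Longrightarrow> primitive (u i)"
  obtains S where "S \<subseteq> A" "card S = 2" "2 dvd sum u S"
proof -
  have "\<exists>i\<in>A. \<exists>j\<in>A. i \<noteq> j \<and> (par1 (u i), par2 (u i)) = (par1 (u j), par2 (u j))"
    using fin prim card
    by (intro pigeonhole_pair[where C = "{(True, False), (False, True), (True, True)}"])
      (auto simp: primitive_iff)
  then obtain i j where "i \<in> A" "j \<in> A" "i \<noteq> j" "par1 (u i) = par1 (u j)" "par2 (u i) = par2 (u j)"
    by blast
  then show ?thesis by (intro that[of "{i, j}"]) (auto simp: two_dvd_zadic2_phi)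
qed

text \<open>Three nonzero elements of F_4 either repeat or are all of them, with sum 0.\<close>

lemma primitive_triple:
  assumes card: "3 \<le> card A" and prim: "\<And>i. i \<in> A \<Longrightarrow> primitive (u i)"
  shows "\<exists>S\<subseteq>A. S \<noteq> {} \<and> 2 dvd sum u S"
proof -
  obtain B where "B \<subseteq> A" "card B = 3" using card by (meson obtain_subset_with_card_n)
  then obtain i j k where ijk: "i \<in> A" "j \<in> A" "k \<in> A" "i \<noteq> j" "i \<noteq> k" "j \<noteq> k"
    by (auto simp: card_3_iff)
  then have "2 dvd sum u {i, j} \<or> 2 dvd sum u {i, k} \<or> 2 dvd sum u {j, k} \<or> 2 dvd sum u {i, j, k}"
    using prim[of i] prim[of j] prim[of k] by (auto simp: two_dvd_zadic2_phi primitive_iff)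
  with ijk show ?thesis by (metis empty_subsetI insert_not_empty insert_subset)
qed

(* R x a b says that x has class (a, b) in (Z/2)^2; the block lemmas below are the bounds for short
   zero sums in (Z/2)^2 and Z/2, applied to sums over blocks. *)
context
  fixes R :: "zadic2_phi \<Rightarrow> bool \<Rightarrow> bool \<Rightarrow> bool" and u :: "'i \<Rightarrow> zadic2_phi"
  assumes add: "\<And>x y a b c d. R x a b \<Longrightarrow> R y c d \<Longrightarrow> R (x + y) (a \<noteq> c) (b \<noteq> d)"
begin

lemma block_union:
  assumes "R (sum u S) a b" "R (sum u T) c d" "finite S" "finite T" "S \<inter> T = {}"
  shows "R (sum u (S \<union> T)) (a \<noteq> c) (b \<noteq> d)"
  using assms add by (simp add: sum.union_disjoint)

text \<open>Three vectors in a plane over F_2 are dependent, and over F_2 a dependency is a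
  vanishing subset sum.\<close>

lemma three_blocks:
  assumes fin: "finite S1" "finite S2" "finite S3"
    and disj: "S1 \<inter> S2 = {}" "S1 \<inter> S3 = {}" "S2 \<inter> S3 = {}"
    and R: "R (sum u S1) a1 b1" "R (sum u S2) a2 b2" "R (sum u S3) a3 b3"
  shows "\<exists>S\<in>{S1, S2, S3, S1 \<union> S2, S1 \<union> S3, S2 \<union> S3, S1 \<union> S2 \<union> S3}. R (sum u S) False False"
proof -
  have 12: "R (sum u (S1 \<union> S2)) (a1 \<noteq> a2) (b1 \<noteq> b2)"
    and 13: "R (sum u (S1 \<union> S3)) (a1 \<noteq> a3) (b1 \<noteq> b3)"
    and 23: "R (sum u (S2 \<union> S3)) (a2 \<noteq> a3) (b2 \<noteq> b3)"
    using assms by (auto intro!: block_union simp del: not_iff)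
  have 123: "R (sum u (S1 \<union> S2 \<union> S3)) ((a1 \<noteq> a2) \<noteq> a3) ((b1 \<noteq> b2) \<noteq> b3)"
    using assms 12 by (intro block_union) auto
  have "\<not> a1 \<and> \<not> b1 \<or> \<not> a2 \<and> \<not> b2 \<or> \<not> a3 \<and> \<not> b3 \<or> a1 = a2 \<and> b1 = b2
      \<or> a1 = a3 \<and> b1 = b3 \<or> a2 = a3 \<and> b2 = b3 \<or> a3 = (a1 \<noteq> a2) \<and> b3 = (b1 \<noteq> b2)"
    by blast
  then show ?thesis
    using R 12 13 23 123 by (elim disjE conjE) simp_all
qed

text \<open>Of four vectors in F_2 ^ 2 one vanishes or two coincide, so at most two blocks are
  joined; this keeps the zero sum short.\<close>

lemma four_blocks:
  assumes fin: "finite S1" "finite S2" "finite S3" "finite S4"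
    and disj: "S1 \<inter> S2 = {}" "S1 \<inter> S3 = {}" "S1 \<inter> S4 = {}" "S2 \<inter> S3 = {}" "S2 \<inter> S4 = {}" "S3 \<inter> S4 = {}"
    and R: "R (sum u S1) a1 b1" "R (sum u S2) a2 b2" "R (sum u S3) a3 b3" "R (sum u S4) a4 b4"
  shows "\<exists>S\<in>{S1, S2, S3, S4, S1 \<union> S2, S1 \<union> S3, S1 \<union> S4, S2 \<union> S3, S2 \<union> S4, S3 \<union> S4}.
    R (sum u S) False False"
proof -
  have "R (sum u (S1 \<union> S2)) (a1 \<noteq> a2) (b1 \<noteq> b2)" "R (sum u (S1 \<union> S3)) (a1 \<noteq> a3) (b1 \<noteq> b3)"
    "R (sum u (S1 \<union> S4)) (a1 \<noteq> a4) (b1 \<noteq> b4)" "R (sum u (S2 \<union> S3)) (a2 \<noteq> a3) (b2 \<noteq> b3)"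
    "R (sum u (S2 \<union> S4)) (a2 \<noteq> a4) (b2 \<noteq> b4)" "R (sum u (S3 \<union> S4)) (a3 \<noteq> a4) (b3 \<noteq> b4)"
    using assms by (auto intro!: block_union simp del: not_iff)
  moreover have "\<not> a1 \<and> \<not> b1 \<or> \<not> a2 \<and> \<not> b2 \<or> \<not> a3 \<and> \<not> b3 \<or> \<not> a4 \<and> \<not> b4
      \<or> a1 = a2 \<and> b1 = b2 \<or> a1 = a3 \<and> b1 = b3 \<or> a1 = a4 \<and> b1 = b4
      \<or> a2 = a3 \<and> b2 = b3 \<or> a2 = a4 \<and> b2 = b4 \<or> a3 = a4 \<and> b3 = b4"
    by blast
  ultimately show ?thesis
    using R by (elim disjE conjE) simp_all
qed

lemma two_blocks:
  assumes "finite S1" "finite S2" "S1 \<inter> S2 = {}" "R (sum u S1) a False" "R (sum u S2) b False"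
  shows "\<exists>S\<in>{S1, S2, S1 \<union> S2}. R (sum u S) False False"
  using assms block_union[of S1 a False S2 b False] by (cases a; cases b) simp_all

end

text \<open>The class of x / 2 in F_4, stated as a relation to avoid division.\<close>

definition half_class :: "zadic2_phi \<Rightarrow> bool \<Rightarrow> bool \<Rightarrow> bool" where
  "half_class x a b \<longleftrightarrow> (\<exists>t. x = 2 * t \<and> par1 t = a \<and> par2 t = b)"

lemma half_class_add:
  assumes "half_class x a b" "half_class y c d"
  shows "half_class (x + y) (a \<noteq> c) (b \<noteq> d)"
proof -
  obtain s t where "x = 2 * s" "par1 s = a" "par2 s = b" "y = 2 * t" "par1 t = c" "par2 t = d"
    using assms by (auto simp: half_class_def)
  then show ?thesis unfolding half_class_def
    by (intro exI[of _ "s + t"]) (simp add: algebra_simps)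
qed

lemma half_class_ex: "2 dvd x \<Longrightarrow> \<exists>a b. half_class x a b"
  by (auto simp: half_class_def elim!: dvdE)

lemma half_class_False:
  assumes "half_class x False False"
  shows "4 dvd x"
proof -
  obtain t where "x = 2 * t" "2 dvd t" using assms by (auto simp: half_class_def two_dvd_zadic2_phi)
  then show ?thesis using mult_dvd_mono[of 2 2 2 t] by simp
qed

text \<open>Here 7 = 2 + 2 + 3: two even pairs leave three units, which contain a third even block,
  and three classes of half sums in F_4 have a zero sum.\<close>

lemma zero_sum_mod_4:
  assumes fin: "finite A" and card: "7 \<le> card A" and prim: "\<And>i. i \<in> A \<Longrightarrow> primitive (u i)"
  shows "\<exists>S\<subseteq>A. S \<noteq> {} \<and> 4 dvd sum u S"
proof -
  obtain S1 where S1: "S1 \<subseteq> A" "card S1 = 2" "2 dvd sum u S1"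
    using primitive_pair[of A u] fin card prim by force
  then have A1: "card (A - S1) = card A - 2"
    using fin by (simp add: card_Diff_subset finite_subset)
  obtain S2 where S2: "S2 \<subseteq> A - S1" "card S2 = 2" "2 dvd sum u S2"
    using primitive_pair[of "A - S1" u] A1 fin card prim by force
  then have A2: "card (A - S1 - S2) = card A - 4"
    using fin A1 by (simp add: card_Diff_subset finite_subset)
  have "\<exists>S\<subseteq>A - S1 - S2. S \<noteq> {} \<and> 2 dvd sum u S"
    by (rule primitive_triple) (use A2 card prim in auto)
  then obtain S3 where S3: "S3 \<subseteq> A - S1 - S2" "S3 \<noteq> {}" "2 dvd sum u S3" by blast
  obtain a1 b1 a2 b2 a3 b3 where R: "half_class (sum u S1) a1 b1" "half_class (sum u S2) a2 b2"
    "half_class (sum u S3) a3 b3"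
    using S1(3) S2(3) S3(3) half_class_ex by meson
  have "finite S1" "finite S2" "finite S3"
    using fin S1 S2 S3 by (auto dest: finite_subset)
  moreover have "S1 \<inter> S2 = {}" "S1 \<inter> S3 = {}" "S2 \<inter> S3 = {}" using S2 S3 by auto
  ultimately obtain S where S: "S \<in> {S1, S2, S3, S1 \<union> S2, S1 \<union> S3, S2 \<union> S3, S1 \<union> S2 \<union> S3}"
    "half_class (sum u S) False False"
    using three_blocks[of half_class, OF half_class_add _ _ _ _ _ _ R] by blast
  have "S \<subseteq> A" "S \<noteq> {}" using S(1) S1 S2 S3 by auto
  then show ?thesis using half_class_False[OF S(2)] by blast
qed

text \<open>Here 10 = 2 + 2 + 2 + 4: four disjoint even pairs exist, and at most two of them are
  joined.\<close>

lemma short_zero_sum_mod_4: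
  assumes fin: "finite A" and card: "10 \<le> card A" and prim: "\<And>i. i \<in> A \<Longrightarrow> primitive (u i)"
  shows "\<exists>S\<subseteq>A. S \<noteq> {} \<and> card S \<le> 4 \<and> 4 dvd sum u S"
proof -
  obtain S1 where S1: "S1 \<subseteq> A" "card S1 = 2" "2 dvd sum u S1"
    using primitive_pair[of A u] fin card prim by force
  then have A1: "card (A - S1) = card A - 2"
    using fin by (simp add: card_Diff_subset finite_subset)
  obtain S2 where S2: "S2 \<subseteq> A - S1" "card S2 = 2" "2 dvd sum u S2"
    using primitive_pair[of "A - S1" u] A1 fin card prim by force
  then have A2: "card (A - S1 - S2) = card A - 4"
    using fin A1 by (simp add: card_Diff_subset finite_subset)
  obtain S3 where S3: "S3 \<subseteq> A - S1 - S2" "card S3 = 2" "2 dvd sum u S3"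
    using primitive_pair[of "A - S1 - S2" u] A2 fin card prim by force
  then have A3: "card (A - S1 - S2 - S3) = card A - 6"
    using fin A2 by (simp add: card_Diff_subset finite_subset)
  obtain S4 where S4: "S4 \<subseteq> A - S1 - S2 - S3" "card S4 = 2" "2 dvd sum u S4"
    using primitive_pair[of "A - S1 - S2 - S3" u] A3 fin card prim by force
  obtain a1 b1 a2 b2 a3 b3 a4 b4 where R: "half_class (sum u S1) a1 b1" "half_class (sum u S2) a2 b2"
    "half_class (sum u S3) a3 b3" "half_class (sum u S4) a4 b4"
    using S1(3) S2(3) S3(3) S4(3) half_class_ex by meson
  have "finite S1" "finite S2" "finite S3" "finite S4"
    using S1 S2 S3 S4 by (auto intro: card_ge_0_finite)
  moreover have "S1 \<inter> S2 = {}" "S1 \<inter> S3 = {}" "S1 \<inter> S4 = {}" "S2 \<inter> S3 = {}" "S2 \<inter> S4 = {}"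
    "S3 \<inter> S4 = {}" using S2 S3 S4 by auto
  ultimately obtain S where S: "S \<in> {S1, S2, S3, S4, S1 \<union> S2, S1 \<union> S3, S1 \<union> S4, S2 \<union> S3, S2 \<union> S4, S3 \<union> S4}"
    "half_class (sum u S) False False"
    using four_blocks[of half_class, OF half_class_add _ _ _ _ _ _ _ _ _ _ R] by blast
  have "S \<subseteq> A" "S \<noteq> {}" using S(1) S1 S2 S3 S4 by auto
  moreover have "card S \<le> 4"
    using S(1) S1(2) S2(2) S3(2) S4(2) card_Un_le[of S1 S2] card_Un_le[of S1 S3] card_Un_le[of S1 S4]
      card_Un_le[of S2 S3] card_Un_le[of S2 S4] card_Un_le[of S3 S4] by auto
  ultimately show ?thesis using half_class_False[OF S(2)] by blast
qed

(* For primitive c, the kernel of line_form c in F_4 is the line {0, c}. *)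
definition line_form :: "zadic2_phi \<Rightarrow> zadic2_phi \<Rightarrow> bool" where
  "line_form c t \<longleftrightarrow> (par1 c \<and> par2 t) \<noteq> (par2 c \<and> par1 t)"

lemma line_form_add [simp]: "line_form c (s + t) \<longleftrightarrow> line_form c s \<noteq> line_form c t"
  by (auto simp: line_form_def)

lemma line_form_self [simp]: "\<not> line_form c c"
  by (auto simp: line_form_def)

lemma line_form_False:
  assumes "primitive c" "\<not> line_form c t"
  shows "2 dvd t \<or> 2 dvd t - c"
  using assms by (auto simp: line_form_def two_dvd_zadic2_phi primitive_iff)

text \<open>The class of x / 2 in the quotient of F_4 by the line {0, c}. That quotient needs one
  bit only; b is held at \<open>False\<close> to fit the shape of \<open>R\<close> in the block
  lemmas.\<close>

definition half_line_class :: "zadic2_phi \<Rightarrow> zadic2_phi \<Rightarrow> bool \<Rightarrow> bool \<Rightarrow> bool" where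
  "half_line_class c x a b \<longleftrightarrow> (\<exists>t. x = 2 * t \<and> line_form c t = a \<and> \<not> b)"

lemma half_line_class_add:
  assumes "half_line_class g x a b" "half_line_class g y c d"
  shows "half_line_class g (x + y) (a \<noteq> c) (b \<noteq> d)"
proof -
  obtain s t where "x = 2 * s" "line_form g s = a" "\<not> b" "y = 2 * t" "line_form g t = c" "\<not> d"
    using assms by (auto simp: half_line_class_def)
  then show ?thesis unfolding half_line_class_def
    by (intro exI[of _ "s + t"]) (simp add: algebra_simps)
qed

lemma half_line_class_ex: "2 dvd x \<Longrightarrow> \<exists>a. half_line_class c x a False"
  by (auto simp: half_line_class_def elim!: dvdE)

text \<open>Here x / 2 is 0 or c modulo 2. In the second case 2 * c completes x to a multiple of 4,
  and c is going to be the coefficient of a level 1 variable.\<close>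

lemma half_line_class_False:
  assumes "primitive c" "half_line_class c x False False"
  shows "4 dvd x \<or> 4 dvd x + 2 * c"
proof -
  obtain t where t: "x = 2 * t" "\<not> line_form c t" using assms by (auto simp: half_line_class_def)
  have "2 * 2 dvd 2 * t \<or> 2 * 2 dvd 2 * (t + c)"
    using line_form_False[OF assms(1) t(2)]
    by (intro disj_forward[OF _ mult_dvd_mono mult_dvd_mono]) (auto simp: two_dvd_zadic2_phi)
  then show ?thesis by (simp add: t distrib_left)
qed

text \<open>Dividing (Z/4)^2 by 2 * c leaves Z/4 x Z/2. One even pair and an even block from three
  further units suffice, as half sums now carry a single bit.\<close>

lemma zero_sum_mod_4_line:
  assumes fin: "finite A" and card: "5 \<le> card A" and prim: "\<And>i. i \<in> A \<Longrightarrow> primitive (u i)"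
    and c: "primitive c"
  shows "\<exists>S\<subseteq>A. S \<noteq> {} \<and> (4 dvd sum u S \<or> 4 dvd sum u S + 2 * c)"
proof -
  obtain S1 where S1: "S1 \<subseteq> A" "card S1 = 2" "2 dvd sum u S1"
    using primitive_pair[of A u] fin card prim by force
  then have A1: "card (A - S1) = card A - 2"
    using fin by (simp add: card_Diff_subset finite_subset)
  have "\<exists>S\<subseteq>A - S1. S \<noteq> {} \<and> 2 dvd sum u S"
    by (rule primitive_triple) (use A1 card prim in auto)
  then obtain S2 where S2: "S2 \<subseteq> A - S1" "S2 \<noteq> {}" "2 dvd sum u S2" by blast
  obtain a1 a2 where R: "half_line_class c (sum u S1) a1 False" "half_line_class c (sum u S2) a2 False"
    using S1(3) S2(3) half_line_class_ex by meson
  have "finite S1" "finite S2" "S1 \<inter> S2 = {}"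
    using fin S1 S2 by (auto dest: finite_subset)
  then obtain S where S: "S \<in> {S1, S2, S1 \<union> S2}" "half_line_class c (sum u S) False False"
    using two_blocks[of "half_line_class c", OF half_line_class_add _ _ _ R] by blast
  have "S \<subseteq> A" "S \<noteq> {}" using S(1) S1 S2 by auto
  then show ?thesis using half_line_class_False[OF c S(2)] by blast
qed

text \<open>With six units the second block can be a pair as well, which bounds the size by
  4.\<close>

lemma short_zero_sum_mod_4_line:
  assumes fin: "finite A" and card: "6 \<le> card A" and prim: "\<And>i. i \<in> A \<Longrightarrow> primitive (u i)"
    and c: "primitive c"
  shows "\<exists>S\<subseteq>A. S \<noteq> {} \<and> card S \<le> 4 \<and> (4 dvd sum u S \<or> 4 dvd sum u S + 2 * c)"
proof -
  obtain S1 where S1: "S1 \<subseteq> A" "card S1 = 2" "2 dvd sum u S1"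
    using primitive_pair[of A u] fin card prim by force
  then have A1: "card (A - S1) = card A - 2"
    using fin by (simp add: card_Diff_subset finite_subset)
  obtain S2 where S2: "S2 \<subseteq> A - S1" "card S2 = 2" "2 dvd sum u S2"
    using primitive_pair[of "A - S1" u] A1 fin card prim by force
  obtain a1 a2 where R: "half_line_class c (sum u S1) a1 False" "half_line_class c (sum u S2) a2 False"
    using S1(3) S2(3) half_line_class_ex by meson
  have "finite S1" "finite S2" "S1 \<inter> S2 = {}"
    using fin S1 S2 by (auto dest: finite_subset)
  then obtain S where S: "S \<in> {S1, S2, S1 \<union> S2}" "half_line_class c (sum u S) False False"
    using two_blocks[of "half_line_class c", OF half_line_class_add _ _ _ R] by blast
  have "S \<subseteq> A" "S \<noteq> {}" using S(1) S1 S2 by auto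
  moreover have "card S \<le> 4" using S(1) S1(2) S2(2) card_Un_le[of S1 S2] by auto
  ultimately show ?thesis using half_line_class_False[OF c S(2)] by blast
qed

(* Replacing x_i = 1 by sqrt 5 at a coefficient of class c adds 4 c mod 8, so t matters only modulo
   the line spanned by c. *)
definition mono_class :: "zadic2_phi \<Rightarrow> zadic2_phi \<Rightarrow> bool \<Rightarrow> bool \<Rightarrow> bool" where
  "mono_class c x a b \<longleftrightarrow> (\<exists>t. x = (if a then 2 * c else 0) + 4 * t \<and> line_form c t = b)"

lemma mono_class_add:
  assumes "mono_class g x a b" "mono_class g y c d"
  shows "mono_class g (x + y) (a \<noteq> c) (b \<noteq> d)"
proof -
  obtain s t where st: "x = (if a then 2 * g else 0) + 4 * s" "line_form g s = b"
    "y = (if c then 2 * g else 0) + 4 * t" "line_form g t = d"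
    using assms by (auto simp: mono_class_def)
  show ?thesis
  proof (cases "a \<and> c")
    \<comment> \<open>Two summands 2 * g carry over to 4 * g, and g lies in the kernel of
      \<open>line_form g\<close>, so the second bit is unaffected.\<close>
    case True
    with st show ?thesis unfolding mono_class_def
      by (intro exI[of _ "s + t + g"]) (simp add: algebra_simps)
  next
    case False
    with st show ?thesis unfolding mono_class_def
      by (intro exI[of _ "s + t"]) (auto simp: algebra_simps)
  qed
qed

text \<open>Write each coefficient as c + 2 * b. Two of three values b agree modulo the line {0, c},
  so the sum of the two b is 0 or c modulo 2, and the pair sums to 2 * c or to 0 modulo 4.\<close>

lemma mono_pair:
  assumes fin: "finite A" and card: "3 \<le> card A" and c: "primitive c"
    and mono: "\<And>i. i \<in> A \<Longrightarrow> 2 dvd u i - c"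
  shows "\<exists>S\<subseteq>A. card S = 2 \<and> (\<exists>a b. mono_class c (sum u S) a b)"
proof -
  have "\<forall>i\<in>A. \<exists>b. u i = c + 2 * b"
    using mono by (metis add_diff_cancel_left' diff_add_cancel dvdE add.commute)
  then obtain b where b: "\<And>i. i \<in> A \<Longrightarrow> u i = c + 2 * b i" by metis
  have "\<exists>i\<in>A. \<exists>j\<in>A. i \<noteq> j \<and> line_form c (b i) = line_form c (b j)"
    using fin card by (intro pigeonhole_pair[where C = UNIV]) (auto simp: card_UNIV_bool)
  then obtain i j where ij: "i \<in> A" "j \<in> A" "i \<noteq> j" "line_form c (b i) = line_form c (b j)"
    by blast
  then have "\<not> line_form c (b i + b j)" by simp
  then have "2 dvd b i + b j \<or> 2 dvd b i + b j - c" by (rule line_form_False[OF c])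
  moreover have sum: "sum u {i, j} = 2 * c + 2 * (b i + b j)"
    using ij b by (simp add: algebra_simps)
  ultimately have "\<exists>a b. mono_class c (sum u {i, j}) a b"
  proof (elim disjE dvdE)
    fix r assume "b i + b j = 2 * r"
    then have "mono_class c (sum u {i, j}) True (line_form c r)"
      unfolding mono_class_def sum by (intro exI[of _ r]) simp
    then show ?thesis by blast
  next
    fix r assume "b i + b j - c = 2 * r"
    then have "b i + b j = c + 2 * r" by (simp add: algebra_simps)
    then have "mono_class c (sum u {i, j}) False (line_form c (c + r))"
      unfolding mono_class_def sum by (intro exI[of _ "c + r"]) (simp add: algebra_simps)
    then show ?thesis by blast
  qed
  with ij show ?thesis by (metis bot.extremum card_2_iff insert_subset)
qed

text \<open>Here 7 = 2 + 2 + 3, since each pair is drawn from at least three units. Three pairs have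
  a union with both bits 0: a sum 4 * t with t in the line {0, c}, which lifts.\<close>

lemma has_zero_mod_8_mono:
  assumes fin: "finite A" and card: "7 \<le> card A" and "A \<subseteq> I"
    and prim: "\<And>i. i \<in> A \<Longrightarrow> primitive (u i)"
    and mono: "\<And>i j. i \<in> A \<Longrightarrow> j \<in> A \<Longrightarrow> 2 dvd u i - u j"
  shows "has_zero_mod_8 u I J"
proof -
  obtain k where k: "k \<in> A" using card by fastforce
  define c where "c = u k"
  have c: "primitive c" "\<And>i. i \<in> A \<Longrightarrow> 2 dvd u i - c" using k prim mono by (auto simp: c_def)
  have "\<exists>S\<subseteq>A. card S = 2 \<and> (\<exists>a b. mono_class c (sum u S) a b)"
    by (rule mono_pair) (use fin card c in auto)
  then obtain S1 a1 b1 where S1: "S1 \<subseteq> A" "card S1 = 2" "mono_class c (sum u S1) a1 b1"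
    by blast
  then have A1: "card (A - S1) = card A - 2"
    using fin by (simp add: card_Diff_subset finite_subset)
  have "\<exists>S\<subseteq>A - S1. card S = 2 \<and> (\<exists>a b. mono_class c (sum u S) a b)"
    by (rule mono_pair) (use A1 fin card c in auto)
  then obtain S2 a2 b2 where S2: "S2 \<subseteq> A - S1" "card S2 = 2" "mono_class c (sum u S2) a2 b2"
    by blast
  then have A2: "card (A - S1 - S2) = card A - 4"
    using fin A1 by (simp add: card_Diff_subset finite_subset)
  have "\<exists>S\<subseteq>A - S1 - S2. card S = 2 \<and> (\<exists>a b. mono_class c (sum u S) a b)"
    by (rule mono_pair) (use A2 fin card c in auto)
  then obtain S3 a3 b3 where S3: "S3 \<subseteq> A - S1 - S2" "card S3 = 2" "mono_class c (sum u S3) a3 b3"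
    by blast
  have "finite S1" "finite S2" "finite S3"
    using S1 S2 S3 by (auto intro: card_ge_0_finite)
  moreover have "S1 \<inter> S2 = {}" "S1 \<inter> S3 = {}" "S2 \<inter> S3 = {}" using S2 S3 by auto
  ultimately obtain S where S: "S \<in> {S1, S2, S3, S1 \<union> S2, S1 \<union> S3, S2 \<union> S3, S1 \<union> S2 \<union> S3}"
    "mono_class c (sum u S) False False"
    using three_blocks[of "mono_class c", OF mono_class_add _ _ _ _ _ _ S1(3) S2(3) S3(3)] by blast
  have SA: "S \<subseteq> A" "S \<noteq> {}" using S(1) S1 S2 S3 by auto
  obtain t where t: "sum u S = 4 * t" "\<not> line_form c t" using S(2) by (auto simp: mono_class_def)
  obtain i where i: "i \<in> S" using SA by blast
  have "2 dvd u i - c" using c(2) i SA by blast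
  then have "2 dvd t \<or> 2 dvd t - u i"
    using line_form_False[OF c(1) t(2)] by (auto simp: two_dvd_zadic2_phi)
  then have span: "2 dvd t \<or> (\<exists>i\<in>S. 2 dvd t - u i) \<or> (\<exists>i\<in>S. \<exists>j\<in>S. \<not> 2 dvd u i - u j)"
    using i by blast
  show ?thesis
    by (rule has_zero_mod_8I[OF _ SA(2) _ _ _ span, of I "{}"])
      (use SA prim \<open>A \<subseteq> I\<close> t(1) in auto)
qed

section \<open>The cases by the sizes of the two levels\<close>

lemma two_le_cardE:
  assumes "2 \<le> card A"
  obtains x y where "x \<in> A" "y \<in> A" "x \<noteq> y"
proof -
  obtain B where "B \<subseteq> A" "card B = 2" using assms by (meson obtain_subset_with_card_n)
  then show ?thesis using that by (auto simp: card_2_iff)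
qed

text \<open>A first zero sum modulo 4 of size at most 4 leaves the seven units needed for a
  second.\<close>

lemma has_zero_mod_8_large:
  assumes fin: "finite I" "finite J" and prim: "\<And>i. i \<in> I \<Longrightarrow> primitive (u i)"
    and card: "11 \<le> card I"
  shows "has_zero_mod_8 u I J"
proof -
  have "\<exists>S\<subseteq>I. S \<noteq> {} \<and> card S \<le> 4 \<and> 4 dvd sum u S"
    by (rule short_zero_sum_mod_4) (use fin card prim in auto)
  then obtain S1 where S1: "S1 \<subseteq> I" "S1 \<noteq> {}" "card S1 \<le> 4" "4 dvd sum u S1" by blast
  have "card (I - S1) = card I - card S1"
    using fin S1 by (simp add: card_Diff_subset finite_subset)
  then have "7 \<le> card (I - S1)" using S1(3) card by simp
  then have "\<exists>S\<subseteq>I - S1. S \<noteq> {} \<and> 4 dvd sum u S"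
    by (intro zero_sum_mod_4) (use fin prim in auto)
  then obtain S2 where S2: "S2 \<subseteq> I - S1" "S2 \<noteq> {}" "4 dvd sum u S2" by blast
  show ?thesis
    by (rule has_zero_mod_8_two_disjoint[of I J u S1 S2 "{}" "{}"]) (use fin prim S1 S2 in auto)
qed

text \<open>The first sum uses at most 4 of 9 units and leaves 5 for the second. Each is completed
  by its own level 1 variable, j or k, so the two zero sums stay disjoint.\<close>

lemma has_zero_mod_8_medium:
  assumes fin: "finite I" "finite J" and prim: "\<And>i. i \<in> I \<union> J \<Longrightarrow> primitive (u i)"
    and card: "9 \<le> card I" "2 \<le> card J"
  shows "has_zero_mod_8 u I J"
proof -
  obtain j k where jk: "j \<in> J" "k \<in> J" "j \<noteq> k" using card(2) by (rule two_le_cardE)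
  have "\<exists>S\<subseteq>I. S \<noteq> {} \<and> card S \<le> 4 \<and> (4 dvd sum u S \<or> 4 dvd sum u S + 2 * u j)"
    by (rule short_zero_sum_mod_4_line) (use fin card prim jk in auto)
  then obtain S1 where S1: "S1 \<subseteq> I" "S1 \<noteq> {}" "card S1 \<le> 4"
    "4 dvd sum u S1 \<or> 4 dvd sum u S1 + 2 * u j" by blast
  have "card (I - S1) = card I - card S1"
    using fin S1 by (simp add: card_Diff_subset finite_subset)
  then have "5 \<le> card (I - S1)" using S1(3) card by simp
  then have "\<exists>S\<subseteq>I - S1. S \<noteq> {} \<and> (4 dvd sum u S \<or> 4 dvd sum u S + 2 * u k)"
    by (intro zero_sum_mod_4_line) (use fin prim jk in auto)
  then obtain S2 where S2: "S2 \<subseteq> I - S1" "S2 \<noteq> {}" "4 dvd sum u S2 \<or> 4 dvd sum u S2 + 2 * u k"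
    by blast
  have "\<exists>T\<subseteq>{j}. 4 dvd sum u S1 + 2 * sum u T"
  proof -
    have "4 dvd sum u S1 + 2 * sum u {} \<or> 4 dvd sum u S1 + 2 * sum u {j}" using S1(4) by simp
    then show ?thesis by blast
  qed
  then obtain T1 where T1: "T1 \<subseteq> {j}" "4 dvd sum u S1 + 2 * sum u T1" by blast
  have "\<exists>T\<subseteq>{k}. 4 dvd sum u S2 + 2 * sum u T"
  proof -
    have "4 dvd sum u S2 + 2 * sum u {} \<or> 4 dvd sum u S2 + 2 * sum u {k}" using S2(3) by simp
    then show ?thesis by blast
  qed
  then obtain T2 where T2: "T2 \<subseteq> {k}" "4 dvd sum u S2 + 2 * sum u T2" by blast
  have "T1 \<inter> T2 = {}" "T1 \<subseteq> J" "T2 \<subseteq> J" using T1 T2 jk by blast+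
  then show ?thesis
    by (intro has_zero_mod_8_two_disjoint[of I J u S1 S2 T1 T2])
      (use fin S1 S2 T1(2) T2(2) prim in auto)
qed

text \<open>No class contains more than 6 of the at least 8 units. So either all three nonzero
  classes of F_4 occur, and one unit of each sums to 0 modulo 2, or two classes occur at least twice
  each, and a pair from both is even.\<close>

lemma bichromatic_even_sum:
  assumes fin: "finite I" and prim: "\<And>i. i \<in> I \<Longrightarrow> primitive (u i)" and card: "8 \<le> card I"
    and no_mono: "\<And>A. A \<subseteq> I \<Longrightarrow> 7 \<le> card A \<Longrightarrow> \<exists>i\<in>A. \<exists>j\<in>A. \<not> 2 dvd u i - u j"
  obtains S i j where "S \<subseteq> I" "2 dvd sum u S" "i \<in> S" "j \<in> S" "\<not> 2 dvd u i - u j"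
proof -
  define F where "F p q = {i \<in> I. par1 (u i) = p \<and> par2 (u i) = q}" for p q
  have F: "i \<in> F p q \<Longrightarrow> i \<in> I \<and> par1 (u i) = p \<and> par2 (u i) = q" for i p q by (simp add: F_def)
  have "card (F p q) < 7" for p q
  proof (rule ccontr)
    assume "\<not> card (F p q) < 7"
    then obtain i j where "i \<in> F p q" "j \<in> F p q" "\<not> 2 dvd u i - u j"
      using no_mono[of "F p q"] by (auto simp: F_def)
    then show False by (auto simp: two_dvd_zadic2_phi F_def)
  qed
  then have le: "card (F True False) \<le> 6" "card (F False True) \<le> 6" "card (F True True) \<le> 6"
    by (simp_all add: less_Suc_eq_le[symmetric])
  have "I = F True False \<union> F False True \<union> F True True"
    using prim by (auto simp: F_def primitive_iff)
  then have "card I \<le> card (F True False) + card (F False True) + card (F True True)"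
    by (metis add_le_mono1 card_Un_le order_trans)
  then consider "card (F True False) \<noteq> 0" "card (F False True) \<noteq> 0" "card (F True True) \<noteq> 0"
    | "card (F True False) \<ge> 2" "card (F False True) \<ge> 2"
    | "card (F True False) \<ge> 2" "card (F True True) \<ge> 2"
    | "card (F False True) \<ge> 2" "card (F True True) \<ge> 2"
    using le card by linarith
  then consider i j k where "i \<in> F True False" "j \<in> F False True" "k \<in> F True True"
    | p q r s where "(p, q) \<noteq> (r, s)" "card (F p q) \<ge> 2" "card (F r s) \<ge> 2"
  proof cases
    case 1
    then have "F True False \<noteq> {}" "F False True \<noteq> {}" "F True True \<noteq> {}" by auto
    then show ?thesis using that(1) by blast
  qed (use that(2) in blast)+
  then show ?thesis
  proof cases
    case 1
    note ijk = 1[THEN F]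
    then have "i \<noteq> j" "i \<noteq> k" "j \<noteq> k" by auto
    then show ?thesis
      by (intro that[of "{i, j, k}" i j]) (use ijk in \<open>auto simp: two_dvd_zadic2_phi\<close>)
  next
    case 2
    obtain i i' where i: "i \<in> F p q" "i' \<in> F p q" "i \<noteq> i'" using 2(2) by (rule two_le_cardE)
    obtain j j' where j: "j \<in> F r s" "j' \<in> F r s" "j \<noteq> j'" using 2(3) by (rule two_le_cardE)
    note ij = i(1,2)[THEN F] j(1,2)[THEN F]
    have "i \<noteq> j" "i \<noteq> j'" "i' \<noteq> j" "i' \<noteq> j'" using ij 2(1) by auto
    then show ?thesis
      by (intro that[of "{i, i', j, j'}" i j])
        (use ij i(3) j(3) 2(1) in \<open>auto simp: two_dvd_zadic2_phi\<close>)
  qed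
qed

text \<open>Seven units of one class are handled alone. Otherwise an even sum with two classes
  exists at level 0; the classes of j and k span F_4, so level 1 makes it 0 modulo 4, and its two
  classes lift it modulo 8.\<close>

lemma has_zero_mod_8_bichromatic:
  assumes fin: "finite I" and prim: "\<And>i. i \<in> I \<union> J \<Longrightarrow> primitive (u i)" and card: "8 \<le> card I"
    and jk: "j \<in> J" "k \<in> J" "\<not> 2 dvd u j - u k"
  shows "has_zero_mod_8 u I J"
proof (cases "\<exists>A\<subseteq>I. 7 \<le> card A \<and> (\<forall>i\<in>A. \<forall>j\<in>A. 2 dvd u i - u j)")
  case True
  then obtain A where A: "A \<subseteq> I" "7 \<le> card A" "\<And>i j. i \<in> A \<Longrightarrow> j \<in> A \<Longrightarrow> 2 dvd u i - u j"
    by blast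
  show ?thesis
    by (rule has_zero_mod_8_mono[of A]) (use A fin prim in \<open>auto intro: finite_subset\<close>)
next
  case False
  obtain S i i' where S: "S \<subseteq> I" "2 dvd sum u S" "i \<in> S" "i' \<in> S" "\<not> 2 dvd u i - u i'"
    by (rule bichromatic_even_sum[of I u]) (use fin prim card False in blast)+
  obtain s where s: "sum u S = 2 * s" using S(2) by (rule dvdE)
  have "j \<noteq> k" using jk(3) by auto
  have "2 dvd s + sum u {} \<or> 2 dvd s + sum u {j} \<or> 2 dvd s + sum u {k} \<or> 2 dvd s + sum u {j, k}"
    using prim[of j] prim[of k] jk \<open>j \<noteq> k\<close> by (auto simp: two_dvd_zadic2_phi primitive_iff)
  then have "\<exists>T\<subseteq>J. 2 dvd s + sum u T" using jk(1,2) by (metis empty_subsetI insert_subset)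
  then obtain T t where T: "T \<subseteq> J" and t: "s + sum u T = 2 * t" by (auto elim!: dvdE)
  have "sum u S + 2 * sum u T = 2 * (s + sum u T)" by (simp add: s distrib_left)
  then have "sum u S + 2 * sum u T = 4 * t" by (simp add: t)
  from has_zero_mod_8I[OF S(1) _ T _ this] S prim show ?thesis by blast
qed

text \<open>In the second alternative the zero lives on level 1 alone, which then plays the role of
  the leading level.\<close>

lemma has_zero_mod_8_ex:
  assumes fin: "finite I" "finite J" and prim: "\<And>i. i \<in> I \<union> J \<Longrightarrow> primitive (u i)"
    and card: "8 \<le> card I" "15 \<le> card I + card J"
  shows "has_zero_mod_8 u I J \<or> has_zero_mod_8 u J {}"
proof -
  consider "11 \<le> card I" | "9 \<le> card I" "2 \<le> card J" | "7 \<le> card J"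
    using card by linarith
  then show ?thesis
  proof cases
    case 1
    then show ?thesis using has_zero_mod_8_large[of I J u] fin prim by blast
  next
    case 2
    then show ?thesis using has_zero_mod_8_medium[of I J u] fin prim by blast
  next
    case 3
    show ?thesis
    proof (cases "\<forall>j\<in>J. \<forall>k\<in>J. 2 dvd u j - u k")
      case True
      then have "has_zero_mod_8 u J {}"
        using 3 prim by (intro has_zero_mod_8_mono[of J]) (auto simp: fin)
      then show ?thesis ..
    next
      case False
      then show ?thesis using has_zero_mod_8_bichromatic[of I J u] fin prim card(1) by blast
    qed
  qed
qed

section \<open>Zeros of additive forms\<close>

lemma zero_of_has_zero_mod_8:
  fixes u :: "'i \<Rightarrow> zadic2_phi"
  assumes zero: "has_zero_mod_8 u I J" and fin: "finite I" "finite J" and disj: "I \<inter> J = {}"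
    and prim: "\<And>i. i \<in> I \<Longrightarrow> primitive (u i)" and m: "odd m"
  obtains y where "\<exists>i\<in>I. y i \<noteq> 0"
    "(\<Sum>i\<in>I. u i * y i ^ (2 * m)) + 2 * (\<Sum>i\<in>J. u i * y i ^ (2 * m)) = 0"
proof -
  obtain S S' T where S: "S \<subseteq> I" "S \<noteq> {}" "S' \<subseteq> S" "T \<subseteq> J"
    and 8: "8 dvd sum u S + 4 * sum u S' + 2 * sum u T"
    using zero unfolding has_zero_mod_8_def by blast
  have fin': "finite S" "finite S'" "finite T" using S fin by (auto dest: finite_subset)
  obtain i where i: "i \<in> S" using S by blast
  \<comment> \<open>This is sqrt 5 = 2 * phi - 1.\<close>
  define r5 where "r5 = ZPhi (- 1) 2"
  have "r5 ^ 2 = 5"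
  proof -
    have 2: "one_part 2 = 2" "phi_part 2 = 0"
      using zadic2_phi_sel(5,6)[of 1 1] by simp_all
    have 4: "one_part 4 = 4" "phi_part 4 = 0"
      using zadic2_phi_sel(5,6)[of 2 2] 2 by simp_all
    have 5: "one_part 5 = 5" "phi_part 5 = 0"
      using zadic2_phi_sel(5,6)[of 4 1] 4 by simp_all
    show ?thesis
      by (rule zadic2_phi_eqI) (simp_all add: r5_def 5 power2_eq_square times_zadic2_phi_def)
  qed
  then have r5: "r5 ^ (2 * m) = 5 ^ m" by (simp add: power_mult)
  \<comment> \<open>For odd m = 2 * k + 1 this is 5 * 25 ^ k, and 25 is 1 modulo 8.\<close>
  obtain l where l: "(5 :: zadic2_phi) ^ m = 5 + 8 * l"
  proof -
    obtain k where k: "m = 2 * k + 1" using m by (rule oddE)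
    have "(25 :: zadic2_phi) - 1 dvd 25 ^ k - 1" by (metis dvd_triv_left power_diff_1_eq)
    then obtain l where "(25 :: zadic2_phi) ^ k - 1 = 24 * l" by (auto elim!: dvdE)
    then have "(25 :: zadic2_phi) ^ k = 1 + 24 * l" by (simp add: algebra_simps)
    moreover have "(5 :: zadic2_phi) ^ m = 5 * 25 ^ k" by (simp add: k power_mult)
    ultimately have "(5 :: zadic2_phi) ^ m = 5 + 8 * (15 * l)" by (simp add: algebra_simps)
    then show ?thesis by (rule that)
  qed
  define y0 where "y0 k = (if k \<in> S' then r5 else if k \<in> S \<union> T then 1 else 0)" for k
  have m0: "m > 0" using m by (rule odd_pos)
  have "y0 k ^ (2 * m) = (if k \<in> S then 1 else 0) + (if k \<in> S' then 4 + 8 * l else 0)" if "k \<in> I" for k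
    using that S disj m0 by (auto simp: y0_def r5 l power_0_left)
  then have "(\<Sum>k\<in>I. u k * y0 k ^ (2 * m))
      = (\<Sum>k\<in>I. (if k \<in> S then u k else 0) + (if k \<in> S' then (4 + 8 * l) * u k else 0))"
    by (intro sum.cong) (auto simp: algebra_simps)
  also have "\<dots> = sum u S + (4 + 8 * l) * sum u S'"
  proof -
    have "I \<inter> S = S" "I \<inter> S' = S'" using S by auto
    then show ?thesis
      using fin by (simp add: sum.distrib sum.inter_restrict[symmetric] sum_distrib_left)
  qed
  finally have SI: "(\<Sum>k\<in>I. u k * y0 k ^ (2 * m)) = sum u S + (4 + 8 * l) * sum u S'" .
  have "(\<Sum>k\<in>J. u k * y0 k ^ (2 * m)) = (\<Sum>k\<in>J. if k \<in> T then u k else 0)"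
    using S disj m0 by (intro sum.cong) (auto simp: y0_def power_0_left)
  also have "\<dots> = sum u T"
    using fin S(4) by (simp add: sum.inter_restrict[symmetric] Int_absorb1)
  finally have SJ: "(\<Sum>k\<in>J. u k * y0 k ^ (2 * m)) = sum u T" .
  \<comment> \<open>Only variable i is left free; all other terms form the constant of the Hensel
    problem.\<close>
  define R where "R = (\<Sum>k\<in>I - {i}. u k * y0 k ^ (2 * m)) + 2 * (\<Sum>k\<in>J. u k * y0 k ^ (2 * m))"
  have iI: "i \<in> I" "i \<notin> J" using i S disj by auto
  have "u i * y0 i ^ (2 * m) + R = (\<Sum>k\<in>I. u k * y0 k ^ (2 * m)) + 2 * sum u T"
    using fin iI by (simp add: R_def sum.remove[of I i] SJ)
  also have "\<dots> = (sum u S + 4 * sum u S' + 2 * sum u T) + 8 * (l * sum u S')"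
    unfolding SI by (simp add: algebra_simps)
  finally have "8 dvd u i * y0 i ^ (2 * m) + R" using 8 by simp
  moreover have "2 dvd y0 i - 1"
    using i two_dvd_zadic2[of 2] by (auto simp: y0_def r5_def two_dvd_zadic2_phi par1_def par2_def)
  ultimately obtain z where z: "2 dvd z - 1" "u i * z ^ (2 * m) + R = 0"
    using hensel[OF prim[OF iI(1)] m] by blast
  have "z \<noteq> 0" using z(1) by (auto simp: two_dvd_zadic2_phi)
  define y where "y = y0(i := z)"
  have "(\<Sum>k\<in>I. u k * y k ^ (2 * m)) = u i * z ^ (2 * m) + (\<Sum>k\<in>I - {i}. u k * y0 k ^ (2 * m))"
    using fin iI by (simp add: sum.remove[of I i] y_def)
  moreover have "(\<Sum>k\<in>J. u k * y k ^ (2 * m)) = (\<Sum>k\<in>J. u k * y0 k ^ (2 * m))"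
    using iI by (intro sum.cong) (auto simp: y_def)
  ultimately have "(\<Sum>k\<in>I. u k * y k ^ (2 * m)) + 2 * (\<Sum>k\<in>J. u k * y k ^ (2 * m)) = 0"
    using z(2) by (simp add: R_def add.assoc)
  moreover have "\<exists>k\<in>I. y k \<noteq> 0" using iI \<open>z \<noteq> 0\<close> by (auto simp: y_def)
  ultimately show ?thesis using that by blast
qed

section \<open>Embedding of O into K and normal form of the coefficients\<close>

definition of_zadic2 :: "zadic2 \<Rightarrow> qadic2" where
  "of_zadic2 a = Fract a 1"

lemma of_zadic2_hom:
  "of_zadic2 0 = 0" "of_zadic2 1 = 1" "of_zadic2 (a + b) = of_zadic2 a + of_zadic2 b"
  "of_zadic2 (a * b) = of_zadic2 a * of_zadic2 b"
  by (simp_all add: of_zadic2_def Zero_fract_def One_fract_def)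

lemma of_zadic2_eq_0_iff [simp]: "of_zadic2 a = 0 \<longleftrightarrow> a = 0"
  by (simp add: of_zadic2_def Zero_fract_def eq_fract)

lemma two_neq_0_qadic2: "(2 :: qadic2) \<noteq> 0"
proof -
  \<comment> \<open>Component 2, that is the residue modulo 4, is the first one in which 2 does not
    vanish.\<close>
  have "residue (1 + 1) 2 \<noteq> 0" unfolding residue_simps by simp
  then have "(1 + 1 :: zadic2) \<noteq> 0" by (metis zero_zadic2.rep_eq)
  then have "of_zadic2 1 + of_zadic2 1 \<noteq> 0"
    unfolding of_zadic2_hom(3)[symmetric] of_zadic2_eq_0_iff .
  then show ?thesis by (simp add: of_zadic2_hom)
qed

text \<open>The embedding that sends phi to (1 + sqrt 5) / 2.\<close>

definition of_zadic2_phi :: "zadic2_phi \<Rightarrow> qadic2_sqrt5" where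
  "of_zadic2_phi x = Q2Sqrt5 (of_zadic2 (one_part x) + of_zadic2 (phi_part x) / 2) (of_zadic2 (phi_part x) / 2)"

lemma of_zadic2_phi_hom:
  "of_zadic2_phi 0 = 0" "of_zadic2_phi 1 = 1"
  "of_zadic2_phi (x + y) = of_zadic2_phi x + of_zadic2_phi y"
  "of_zadic2_phi (x * y) = of_zadic2_phi x * of_zadic2_phi y"
proof -
  note defs = of_zadic2_phi_def qadic2_sqrt5_defs of_zadic2_hom
  show "of_zadic2_phi 0 = 0" "of_zadic2_phi 1 = 1" by (simp_all add: defs)
  show "of_zadic2_phi (x + y) = of_zadic2_phi x + of_zadic2_phi y"
    by (simp add: defs add_divide_distrib)
  have four: "(4 :: qadic2) \<noteq> 0"
    using no_zero_divisors[OF two_neq_0_qadic2 two_neq_0_qadic2] by simp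
  have sixteen: "(16 :: qadic2) \<noteq> 0"
    using no_zero_divisors[OF four four] by simp
  obtain a b where x: "x = ZPhi a b" by (cases x)
  obtain c e where y: "y = ZPhi c e" by (cases y)
  show "of_zadic2_phi (x * y) = of_zadic2_phi x * of_zadic2_phi y"
    using two_neq_0_qadic2 four sixteen unfolding x y
    by (simp add: defs times_zadic2_phi_def field_simps)
qed

lemma of_zadic2_phi_power: "of_zadic2_phi (x ^ n) = of_zadic2_phi x ^ n"
  by (induction n) (simp_all add: of_zadic2_phi_hom)

lemma of_zadic2_phi_sum: "of_zadic2_phi (sum f A) = (\<Sum>i\<in>A. of_zadic2_phi (f i))"
  by (induction A rule: infinite_finite_induct) (simp_all add: of_zadic2_phi_hom)

lemma of_zadic2_phi_two: "of_zadic2_phi 2 = 2"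
  by (metis of_zadic2_phi_hom(2,3) one_add_one)

lemma of_zadic2_phi_eq_0_iff [simp]: "of_zadic2_phi x = 0 \<longleftrightarrow> x = 0"
proof
  assume "of_zadic2_phi x = 0"
  then have "phi_part x = 0" "one_part x = 0"
    using two_neq_0_qadic2 by (auto simp: of_zadic2_phi_def zero_qadic2_sqrt5_def of_zadic2_hom)
  then show "x = 0" by (intro zadic2_phi_eqI) simp_all
qed (simp add: of_zadic2_phi_hom)

lemma two_neq_0_qadic2_sqrt5: "(2 :: qadic2_sqrt5) \<noteq> 0"
proof -
  have "rat_part (1 + 1) \<noteq> 0" using two_neq_0_qadic2 by (simp add: qadic2_sqrt5_defs)
  then show ?thesis by (metis one_add_one qadic2_sqrt5.sel(1) zero_qadic2_sqrt5_def)
qed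

text \<open>K is the fraction field of O: the product of the denominators of both coordinates serves
  as w.\<close>

lemma integral_multiple:
  fixes a :: qadic2_sqrt5
  obtains w x where "w \<noteq> 0" "a * of_zadic2_phi w = of_zadic2_phi x"
proof -
  obtain p v where p: "rat_part a = Fract p v" "v \<noteq> 0" by (cases "rat_part a") auto
  obtain q v' where q: "irr_part a = Fract q v'" "v' \<noteq> 0" by (cases "irr_part a") auto
  have *: "rat_part a * of_zadic2 (v * v') = of_zadic2 (p * v')"
    "irr_part a * of_zadic2 (v * v') = of_zadic2 (q * v)"
    using p q by (simp_all add: of_zadic2_def eq_fract mult_ac)
  \<comment> \<open>P + Q * sqrt 5 equals (P - Q) + 2 * Q * phi.\<close>
  let ?w = "ZPhi (v * v') 0" and ?x = "ZPhi (p * v' - q * v) (q * v + q * v)"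
  have double: "of_zadic2 (2 * t) = 2 * of_zadic2 t" for t
    by (metis of_zadic2_hom(3) mult_2)
  have diff: "of_zadic2 (p * v' - q * v) = of_zadic2 (p * v') - of_zadic2 (q * v)"
    by (metis of_zadic2_hom(3) diff_add_cancel eq_diff_eq)
  have "a * of_zadic2_phi ?w = of_zadic2_phi ?x"
  proof (rule qadic2_sqrt5_eqI)
    show "rat_part (a * of_zadic2_phi ?w) = rat_part (of_zadic2_phi ?x)"
      using * two_neq_0_qadic2
      by (simp add: of_zadic2_phi_def times_qadic2_sqrt5_def of_zadic2_hom(1,3) diff double)
    show "irr_part (a * of_zadic2_phi ?w) = irr_part (of_zadic2_phi ?x)"
      using * two_neq_0_qadic2
      by (simp add: of_zadic2_phi_def times_qadic2_sqrt5_def of_zadic2_hom(1,3) double)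
  qed
  moreover have "?w \<noteq> 0" using p q by (simp add: zero_zadic2_phi_def)
  ultimately show ?thesis using that by blast
qed

text \<open>Scaling a variable multiplies its coefficient by a d-th power. This first clears
  denominators and then removes multiples of d from the exponent of 2.\<close>

lemma coefficient_normal_form:
  fixes a :: qadic2_sqrt5
  assumes "a \<noteq> 0" "d > 0"
  shows "\<exists>w l u. w \<noteq> 0 \<and> l < d \<and> primitive u \<and> a * w ^ d = 2 ^ l * of_zadic2_phi u"
proof -
  obtain w x where w: "w \<noteq> 0" "a * of_zadic2_phi w = of_zadic2_phi x" by (rule integral_multiple)
  define v where "v = of_zadic2_phi w"
  have v: "v \<noteq> 0" using w by (simp add: v_def)
  have ax: "a * v ^ d = of_zadic2_phi (x * w ^ (d - 1))"
    using w(2) \<open>d > 0\<close> by (cases d) (simp_all add: v_def of_zadic2_phi_hom of_zadic2_phi_power mult.assoc[symmetric])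
  then have "x * w ^ (d - 1) \<noteq> 0" using v assms(1) of_zadic2_phi_hom(1) by (metis mult_eq_0_iff power_not_zero)
  then obtain n u where u: "x * w ^ (d - 1) = 2 ^ n * u" "primitive u" by (rule zadic2_phi_factor)
  define q where "q = n div d"
  have "n = n mod d + q * d" by (simp add: q_def)
  then have "(2 :: qadic2_sqrt5) ^ n = 2 ^ (n mod d) * (2 ^ q) ^ d"
    by (metis power_add power_mult)
  then have "a * v ^ d = 2 ^ (n mod d) * (2 ^ q) ^ d * of_zadic2_phi u"
    unfolding ax u(1) by (simp add: of_zadic2_phi_hom of_zadic2_phi_power of_zadic2_phi_two)
  then have "a * (v / 2 ^ q) ^ d = 2 ^ (n mod d) * of_zadic2_phi u"
    using two_neq_0_qadic2_sqrt5 by (simp add: power_divide field_simps)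
  moreover have "v / 2 ^ q \<noteq> 0" using v two_neq_0_qadic2_sqrt5 by simp
  moreover have "n mod d < d" using assms by simp
  ultimately show ?thesis using u(2) by blast
qed

section \<open>Choice of the levels and assembly of the zero\<close>

lemma sum_lessThan_cyclic_Suc:
  fixes f :: "nat \<Rightarrow> 'a :: comm_monoid_add"
  assumes "d > 0"
  shows "(\<Sum>j<d. f (Suc j mod d)) = (\<Sum>j<d. f j)"
proof -
  obtain n where d: "d = Suc n" using assms by (cases d) auto
  have "(\<Sum>j<n. f (Suc j mod d)) = (\<Sum>j<n. f (Suc j))"
    by (rule sum.cong) (simp_all add: d)
  then show ?thesis
    unfolding d sum.lessThan_Suc_shift[of f] by (simp add: d add.commute)
qed

(* Writing t = s - 7, failure at every j means that the negative part of t at Suc j mod d dominates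
   its positive part at j, so that t has sum at most 0. *)
lemma cyclic_levels:
  fixes s :: "nat \<Rightarrow> nat"
  assumes "d > 0" "7 * d + 1 \<le> (\<Sum>j<d. s j)"
  shows "\<exists>j<d. 8 \<le> s j \<and> 15 \<le> s j + s (Suc j mod d)"
proof (rule ccontr)
  assume no: "\<not> ?thesis"
  \<comment> \<open>Truncated subtraction yields these positive and negative parts. If
    \<open>s j\<close> is at least 8, failure at j makes the two neighbours sum to at most
    14.\<close>
  have "(\<Sum>j<d. s j - 7) \<le> (\<Sum>j<d. 7 - s (Suc j mod d))"
    using no by (intro sum_mono) force
  also have "\<dots> = (\<Sum>j<d. 7 - s j)"
    using sum_lessThan_cyclic_Suc[OF assms(1), of "\<lambda>j. 7 - s j"] by simp
  finally have le: "(\<Sum>j<d. s j - 7) \<le> (\<Sum>j<d. 7 - s j)" .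
  have "(\<Sum>j<d. s j) + (\<Sum>j<d. 7 - s j) = (\<Sum>j<d. s j - 7) + (\<Sum>j<d. 7)"
    unfolding sum.distrib[symmetric] by (rule sum.cong) auto
  with le assms(2) show False by simp
qed

text \<open>The factor c is the power of 2 common to both levels; variables outside of them are set
  to 0.\<close>

lemma nontrivial_zero_of_has_zero_mod_8:
  fixes a :: "nat \<Rightarrow> qadic2_sqrt5"
  assumes zero: "has_zero_mod_8 u I J" and IJ: "I \<subseteq> {..<s}" "J \<subseteq> {..<s}" "I \<inter> J = {}"
    and prim: "\<And>i. i \<in> I \<Longrightarrow> primitive (u i)" and m: "odd m"
    and w: "\<And>i. i \<in> I \<union> J \<Longrightarrow> w i \<noteq> 0"
    and I: "\<And>i. i \<in> I \<Longrightarrow> a i * w i ^ (2 * m) = c * of_zadic2_phi (u i)"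
    and J: "\<And>i. i \<in> J \<Longrightarrow> a i * w i ^ (2 * m) = c * 2 * of_zadic2_phi (u i)"
  shows "has_nontrivial_zero s (additive_form (2 * m) s a)"
proof -
  have fin: "finite I" "finite J" using IJ by (auto dest: finite_subset)
  obtain y where y: "\<exists>i\<in>I. y i \<noteq> 0"
    "(\<Sum>i\<in>I. u i * y i ^ (2 * m)) + 2 * (\<Sum>i\<in>J. u i * y i ^ (2 * m)) = 0"
    using zero_of_has_zero_mod_8[OF zero fin IJ(3) prim m] by blast
  define x where "x i = (if i \<in> I \<union> J then w i * of_zadic2_phi (y i) else 0)" for i
  have m0: "m > 0" using m by (rule odd_pos)
  have "additive_form (2 * m) s a x = (\<Sum>i\<in>I \<union> J. a i * x i ^ (2 * m))"
    unfolding additive_form_def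
    by (rule sum.mono_neutral_right) (use IJ m0 in \<open>auto simp: x_def power_0_left\<close>)
  also have "\<dots> = (\<Sum>i\<in>I. a i * x i ^ (2 * m)) + (\<Sum>i\<in>J. a i * x i ^ (2 * m))"
    using fin IJ(3) by (rule sum.union_disjoint)
  also have "(\<Sum>i\<in>I. a i * x i ^ (2 * m)) = (\<Sum>i\<in>I. c * of_zadic2_phi (u i * y i ^ (2 * m)))"
    using I by (intro sum.cong)
      (simp_all add: x_def power_mult_distrib of_zadic2_phi_hom of_zadic2_phi_power mult.assoc[symmetric])
  also have "(\<Sum>i\<in>J. a i * x i ^ (2 * m)) = (\<Sum>i\<in>J. c * 2 * of_zadic2_phi (u i * y i ^ (2 * m)))"
    using J by (intro sum.cong)
      (simp_all add: x_def power_mult_distrib of_zadic2_phi_hom of_zadic2_phi_power mult.assoc[symmetric])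
  also have "(\<Sum>i\<in>I. c * of_zadic2_phi (u i * y i ^ (2 * m)))
      + (\<Sum>i\<in>J. c * 2 * of_zadic2_phi (u i * y i ^ (2 * m)))
      = c * of_zadic2_phi ((\<Sum>i\<in>I. u i * y i ^ (2 * m)) + 2 * (\<Sum>i\<in>J. u i * y i ^ (2 * m)))"
    by (simp add: of_zadic2_phi_hom of_zadic2_phi_sum of_zadic2_phi_two sum_distrib_left distrib_left mult.assoc)
  also have "\<dots> = 0" by (simp add: y(2))
  finally have "additive_form (2 * m) s a x = 0" .
  moreover obtain i where "i \<in> I" "y i \<noteq> 0" using y(1) by blast
  then have "i < s" "x i \<noteq> 0" using IJ w[of i] by (auto simp: x_def)
  ultimately show ?thesis unfolding has_nontrivial_zero_def by blast
qed

lemma additive_form_has_nontrivial_zero: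
  fixes a :: "nat \<Rightarrow> qadic2_sqrt5"
  assumes m: "odd m" and s: "7 * (2 * m) + 1 \<le> s"
  shows "has_nontrivial_zero s (additive_form (2 * m) s a)"
proof (cases "\<exists>i<s. a i = 0")
  case True
  then obtain i where i: "i < s" "a i = 0" by blast
  have "additive_form (2 * m) s a (\<lambda>k. if k = i then 1 else 0) = 0"
    unfolding additive_form_def by (rule sum.neutral) (use i odd_pos[OF m] in \<open>auto simp: power_0_left\<close>)
  with i(1) show ?thesis unfolding has_nontrivial_zero_def
    by (intro exI[of _ "\<lambda>k. if k = i then 1 else 0"]) auto
next
  case False
  define d where "d = 2 * m"
  have d: "d > 1" using odd_pos[OF m] by (simp add: d_def)
  have "\<forall>i<s. \<exists>w l u. w \<noteq> 0 \<and> l < d \<and> primitive u \<and> a i * w ^ d = 2 ^ l * of_zadic2_phi u"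
    using False coefficient_normal_form d by auto
  then obtain w l u where wlu: "\<And>i. i < s \<Longrightarrow> w i \<noteq> 0" "\<And>i. i < s \<Longrightarrow> l i < d"
    "\<And>i. i < s \<Longrightarrow> primitive (u i)" "\<And>i. i < s \<Longrightarrow> a i * w i ^ d = 2 ^ l i * of_zadic2_phi (u i)"
    by metis
  define L where "L j = {i. i < s \<and> l i = j}" for j
  have fin: "finite (L j)" for j by (simp add: L_def)
  have "{..<s} = (\<Union>j<d. L j)" using wlu(2) by (auto simp: L_def)
  then have "s = card (\<Union>j<d. L j)" by (metis card_lessThan)
  also have "\<dots> = (\<Sum>j<d. card (L j))"
    by (rule card_UN_disjoint) (auto simp: L_def)
  finally have "7 * d + 1 \<le> (\<Sum>j<d. card (L j))" using s by (simp add: d_def)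
  then obtain j where j: "j < d" "8 \<le> card (L j)" "15 \<le> card (L j) + card (L (Suc j mod d))"
    using cyclic_levels[of d "\<lambda>j. card (L j)"] d by auto
  define I J where "I = L j" and "J = L (Suc j mod d)"
  \<comment> \<open>Since d > 1, the cyclic successor is a different level.\<close>
  have "j \<noteq> Suc j mod d" using d j(1) by (cases "Suc j = d") auto
  then have disj: "I \<inter> J = {}" "I \<subseteq> {..<s}" "J \<subseteq> {..<s}" by (auto simp: I_def J_def L_def)
  have prim: "i \<in> I \<union> J \<Longrightarrow> primitive (u i)" for i using disj wlu(3) by auto
  have "has_zero_mod_8 u I J \<or> has_zero_mod_8 u J {}"
    using has_zero_mod_8_ex[of I J u] fin prim j by (auto simp: I_def J_def)
  then show ?thesis
  proof
    assume *: "has_zero_mod_8 u I J"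
    \<comment> \<open>If j = d - 1, the next level is level 0; scaling its variables by 2 turns it
      into level d = j + 1.\<close>
    define e :: qadic2_sqrt5 where "e = (if Suc j = d then 2 else 1)"
    have e: "e \<noteq> 0" "e ^ d * 2 ^ (Suc j mod d) = 2 ^ j * 2"
      using j(1) two_neq_0_qadic2_sqrt5 by (auto simp: e_def)
    show ?thesis
    proof (rule nontrivial_zero_of_has_zero_mod_8[OF * disj(2,3,1) _ m, where c = "2 ^ j"
        and w = "\<lambda>i. if i \<in> J then e * w i else w i"])
      fix i assume "i \<in> J"
      then have "a i * w i ^ d = 2 ^ (Suc j mod d) * of_zadic2_phi (u i)"
        using wlu(4)[of i] by (simp add: J_def L_def)
      then have "a i * (e * w i) ^ d = e ^ d * 2 ^ (Suc j mod d) * of_zadic2_phi (u i)"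
        by (simp add: power_mult_distrib)
      then show "a i * (if i \<in> J then e * w i else w i) ^ (2 * m) = 2 ^ j * 2 * of_zadic2_phi (u i)"
        using \<open>i \<in> J\<close> unfolding e(2) by (simp add: d_def)
    next
      fix i assume "i \<in> I"
      then show "a i * (if i \<in> J then e * w i else w i) ^ (2 * m) = 2 ^ j * of_zadic2_phi (u i)"
        using wlu(4)[of i] disj(1) by (auto simp: I_def L_def d_def)
    qed (use prim wlu(1) disj e(1) in auto)
  next
    assume *: "has_zero_mod_8 u J {}"
    show ?thesis
      by (rule nontrivial_zero_of_has_zero_mod_8[OF * disj(3) _ _ _ m, where w = w and c = "2 ^ (Suc j mod d)"])
        (use prim wlu disj in \<open>auto simp: J_def L_def d_def\<close>)
  qed
qed

theorem theorem2:
  fixes d m :: nat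
  assumes "d = 2 * m" and "3 \<le> m" and "odd m"
  shows "(\<forall>s\<ge>7 * d + 1. \<forall>a :: nat \<Rightarrow> qadic2_sqrt5. has_nontrivial_zero s (additive_form d s a))
    \<and> Gamma_star d TYPE(qadic2_sqrt5) \<le> 7 * d + 1"
proof -
  have "\<forall>s\<ge>7 * d + 1. \<forall>a :: nat \<Rightarrow> qadic2_sqrt5. has_nontrivial_zero s (additive_form d s a)"
    unfolding \<open>d = 2 * m\<close> using additive_form_has_nontrivial_zero[OF \<open>odd m\<close>] by blast
  then show ?thesis unfolding Gamma_star_def by (blast intro: Least_le)
qed

end
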